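(* Let $q,r\ge2$ be integers. The Plancherel measure $\mu=\mu_{o,o}$ of simple random walk on $\mathrm{DL}(q,r)$ is given by $$\mu(\{\lambda_{m,n}\})=\begin{cases}\dfrac{\log(1-r^{-n})-\log(1-q^{-n})}{n(r-q)}\;\dfrac{2qr(q+r)(q-1)(r-1)\sin^2\frac mn\pi}{(r-q)^2+4qr\sin^2\frac mn\pi},&\text{if } r\ne q,\\[3mm]\dfrac{(q-1)^2}{q^n-1},&\text{if } r=q,\end{cases}$$ where $\lambda_{m,n}=\frac{2\sqrt{qr}}{q+r}\cos\frac mn\pi$ and $m,n$ are relatively prime with $1\le m<n$. (The measure $\mu$ is a countable sum of point masses at these points.)
   Context: Trees. For an integer $p\ge2$, $\mathbb T_p$ is the homogeneous tree of degree $p+1$ with a chosen root $o$ and a chosen reference end $\omega$ (an end is an equivalence class of geodesic rays, two rays being equivalent if their supports have finite symmetric difference). For a vertex $x$, $\overline{x\,\omega}$ is the unique geodesic ray from $x$ representing $\omega$; for vertices $v,z$ the confluent $b=v\curlywedge z$ is defined by $\overline{v\,\omega}\cap\overline{z\,\omega}=\overline{b\,\omega}$. The Busemann function is $\mathfrak h(x)=d(x,x\curlywedge o)-d(o,x\curlywedge o)$. Diestel-Leader graph. Let $\mathbb T_q$, $\mathbb T_r$ have roots $o_1,o_2$ and reference ends $\omega_1,\omega_2$. $\mathrm{DL}(q,r)$ has vertex set $\{x_1x_2\in\mathbb T_q\times\mathbb T_r:\mathfrak h(x_1)+\mathfrak h(x_2)=0\}$, with $x_1x_2\sim y_1y_2$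 iff $x_1\sim y_1$ and $x_2\sim y_2$. It is $(q+r)$-regular and vertex-transitive; $o=o_1o_2$. Plancherel measure. The simple random walk operator $Pf(x)=\frac1{q+r}\sum_{y\sim x}f(y)$ is self-adjoint on $\ell^2(\mathrm{DL}(q,r))$, with resolution of the identity $E$. The Plancherel measure is the probability measure $\mu(d\lambda)=\mu_{o,o}(d\lambda)=\langle\delta_o,E(d\lambda)\delta_o\rangle$, characterized by $\int\lambda^N\,d\mu(\lambda)=p^{(N)}(o,o)$ for all $N\ge0$, where $p^{(N)}(x,y)$ are the matrix elements of $P^N$. *)

theory Defs
  imports "HOL-Analysis.Analysis"
begin

section \<open>Homogeneous trees, ends and the Busemann function\<close>

text \<open>A graph is given by its adjacency relation; the vertex set is the whole type.\<close>

definition graph_path :: "('a \<Rightarrow> 'a \<Rightarrow> bool) \<Rightarrow> 'a list \<Rightarrow> bool" where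
  "graph_path G xs \<longleftrightarrow> xs \<noteq> [] \<and> distinct xs \<and> successively G xs"

definition graph_cycle :: "('a \<Rightarrow> 'a \<Rightarrow> bool) \<Rightarrow> 'a list \<Rightarrow> bool" where
  "graph_cycle G xs \<longleftrightarrow> 3 \<le> length xs \<and> graph_path G xs \<and> G (last xs) (hd xs)"

definition is_tree :: "('a \<Rightarrow> 'a \<Rightarrow> bool) \<Rightarrow> bool" where
  "is_tree G \<longleftrightarrow> symp G \<and> irreflp G \<and> (\<forall>x y. G\<^sup>*\<^sup>* x y) \<and> (\<nexists>xs. graph_cycle G xs)"

text \<open>The tree \<open>T\<^sub>p\<close>, up to isomorphism. Since \<open>p + 1 > 0\<close>, the cardinality condition
  includes finiteness of the neighbourhoods.\<close>

definition homogeneous_tree :: "nat \<Rightarrow> ('a \<Rightarrow> 'a \<Rightarrow> bool) \<Rightarrow> bool" where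
  "homogeneous_tree p G \<longleftrightarrow> is_tree G \<and> (\<forall>x. card {y. G x y} = p + 1)"

definition graph_dist :: "('a \<Rightarrow> 'a \<Rightarrow> bool) \<Rightarrow> 'a \<Rightarrow> 'a \<Rightarrow> nat" where
  "graph_dist G x y = (LEAST n. (G ^^ n) x y)"

definition geodesic_rays :: "('a \<Rightarrow> 'a \<Rightarrow> bool) \<Rightarrow> (nat \<Rightarrow> 'a) set" where
  "geodesic_rays G = {\<xi>. \<forall>i j. i \<le> j \<longrightarrow> graph_dist G (\<xi> i) (\<xi> j) = j - i}"

definition ray_equiv :: "('a \<Rightarrow> 'a \<Rightarrow> bool) \<Rightarrow> ((nat \<Rightarrow> 'a) \<times> (nat \<Rightarrow> 'a)) set" where
  "ray_equiv G = {(\<xi>, \<eta>). \<xi> \<in> geodesic_rays G \<and> \<eta> \<in> geodesic_rays G \<and>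
     finite ((range \<xi> - range \<eta>) \<union> (range \<eta> - range \<xi>))}"

definition ends :: "('a \<Rightarrow> 'a \<Rightarrow> bool) \<Rightarrow> (nat \<Rightarrow> 'a) set set" where
  "ends G = geodesic_rays G // ray_equiv G"

definition ray_to :: "(nat \<Rightarrow> 'a) set \<Rightarrow> 'a \<Rightarrow> nat \<Rightarrow> 'a" where
  "ray_to \<omega> x = (THE \<xi>. \<xi> \<in> \<omega> \<and> \<xi> 0 = x)"

definition confluent :: "(nat \<Rightarrow> 'a) set \<Rightarrow> 'a \<Rightarrow> 'a \<Rightarrow> 'a" where
  "confluent \<omega> v z =
     (THE b. range (ray_to \<omega> v) \<inter> range (ray_to \<omega> z) = range (ray_to \<omega> b))"

definition busemann :: "('a \<Rightarrow> 'a \<Rightarrow> bool) \<Rightarrow> 'a \<Rightarrow> (nat \<Rightarrow> 'a) set \<Rightarrow> 'a \<Rightarrow> int" where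
  "busemann G o' \<omega> x =
     int (graph_dist G x (confluent \<omega> x o')) - int (graph_dist G o' (confluent \<omega> x o'))"


section \<open>The Diestel--Leader graph\<close>

definition DL_verts ::
    "('a \<Rightarrow> 'a \<Rightarrow> bool) \<Rightarrow> 'a \<Rightarrow> (nat \<Rightarrow> 'a) set \<Rightarrow>
     ('b \<Rightarrow> 'b \<Rightarrow> bool) \<Rightarrow> 'b \<Rightarrow> (nat \<Rightarrow> 'b) set \<Rightarrow> ('a \<times> 'b) set" where
  "DL_verts G1 o1 \<omega>1 G2 o2 \<omega>2 =
     {(x1, x2). busemann G1 o1 \<omega>1 x1 + busemann G2 o2 \<omega>2 x2 = 0}"

text \<open>Only meaningful for pairs of elements of \<open>DL_verts\<close>.\<close>

definition DL_adj ::
    "('a \<Rightarrow> 'a \<Rightarrow> bool) \<Rightarrow> ('b \<Rightarrow> 'b \<Rightarrow> bool) \<Rightarrow> 'a \<times> 'b \<Rightarrow> 'a \<times> 'b \<Rightarrow> bool" where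
  "DL_adj G1 G2 x y \<longleftrightarrow> G1 (fst x) (fst y) \<and> G2 (snd x) (snd y)"


section \<open>Square-summable functions and resolutions of the identity\<close>

text \<open>Functions on \<open>V\<close> are represented by functions on the whole type that vanish outside \<open>V\<close>.\<close>

definition ell2 :: "'v set \<Rightarrow> ('v \<Rightarrow> complex) set" where
  "ell2 V = {f. (\<forall>x. x \<notin> V \<longrightarrow> f x = 0) \<and> (\<lambda>x. (cmod (f x))\<^sup>2) summable_on V}"

definition ell2_inner :: "'v set \<Rightarrow> ('v \<Rightarrow> complex) \<Rightarrow> ('v \<Rightarrow> complex) \<Rightarrow> complex" where
  "ell2_inner V f g = (\<Sum>\<^sub>\<infinity>x\<in>V. cnj (f x) * g x)"

definition delta_fun :: "'v \<Rightarrow> 'v \<Rightarrow> complex" where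
  "delta_fun x = (\<lambda>y. if y = x then 1 else 0)"

definition self_adjoint_projection :: "'v set \<Rightarrow> (('v \<Rightarrow> complex) \<Rightarrow> ('v \<Rightarrow> complex)) \<Rightarrow> bool" where
  "self_adjoint_projection V Q \<longleftrightarrow>
     (\<forall>f\<in>ell2 V. Q f \<in> ell2 V \<and> Q (Q f) = Q f) \<and>
     (\<forall>f\<in>ell2 V. \<forall>g\<in>ell2 V. \<forall>a b. Q (\<lambda>x. a * f x + b * g x) = (\<lambda>x. a * Q f x + b * Q g x)) \<and>
     (\<forall>f\<in>ell2 V. \<forall>g\<in>ell2 V. ell2_inner V f (Q g) = ell2_inner V (Q f) g)"

text \<open>Projection-valued measures on the Borel sets of the real line.\<close>

definition resolution_of_identity ::
    "'v set \<Rightarrow> (real set \<Rightarrow> ('v \<Rightarrow> complex) \<Rightarrow> ('v \<Rightarrow> complex)) \<Rightarrow> bool" where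
  "resolution_of_identity V E \<longleftrightarrow>
     (\<forall>B\<in>sets borel. self_adjoint_projection V (E B)) \<and>
     (\<forall>f\<in>ell2 V. E {} f = (\<lambda>x. 0) \<and> E UNIV f = f) \<and>
     (\<forall>A\<in>sets borel. \<forall>B\<in>sets borel. \<forall>f\<in>ell2 V. E (A \<inter> B) f = E A (E B f)) \<and>
     (\<forall>A :: nat \<Rightarrow> real set. range A \<subseteq> sets borel \<longrightarrow> disjoint_family A \<longrightarrow>
        (\<forall>f\<in>ell2 V. \<forall>g\<in>ell2 V.
           (\<lambda>n. ell2_inner V f (E (A n) g)) sums ell2_inner V f (E (\<Union>n. A n) g)))"

text \<open>The measure \<open>B \<mapsto> \<langle>f, E(B) f\<rangle>\<close>. The values \<open>\<langle>f, E(B) f\<rangle> = \<parallel>E(B) f\<parallel>\<^sup>2\<close> are real and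
  nonnegative.\<close>

definition spectral_measure ::
    "'v set \<Rightarrow> (real set \<Rightarrow> ('v \<Rightarrow> complex) \<Rightarrow> ('v \<Rightarrow> complex)) \<Rightarrow> ('v \<Rightarrow> complex) \<Rightarrow> real measure" where
  "spectral_measure V E f =
     measure_of UNIV (sets borel) (\<lambda>B. ennreal (Re (ell2_inner V f (E B f))))"

text \<open>\<open>T = \<integral> \<lambda> dE(\<lambda>)\<close> for an everywhere defined operator \<open>T\<close>, in the weak sense. By polarization
  over the complex scalars it suffices to test on the diagonal, which only involves positive
  measures.\<close>

definition spectral_resolution ::
    "'v set \<Rightarrow> (('v \<Rightarrow> complex) \<Rightarrow> ('v \<Rightarrow> complex)) \<Rightarrow>
     (real set \<Rightarrow> ('v \<Rightarrow> complex) \<Rightarrow> ('v \<Rightarrow> complex)) \<Rightarrow> bool" where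
  "spectral_resolution V T E \<longleftrightarrow>
     resolution_of_identity V E \<and>
     (\<forall>f\<in>ell2 V. integrable (spectral_measure V E f) (\<lambda>t. t) \<and>
        ell2_inner V f (T f) = complex_of_real (\<integral>t. t \<partial>spectral_measure V E f))"


section \<open>Simple random walk\<close>

definition DL_walk_op ::
    "nat \<Rightarrow> nat \<Rightarrow> ('a \<times> 'b) set \<Rightarrow> ('a \<Rightarrow> 'a \<Rightarrow> bool) \<Rightarrow> ('b \<Rightarrow> 'b \<Rightarrow> bool) \<Rightarrow>
     ('a \<times> 'b \<Rightarrow> complex) \<Rightarrow> 'a \<times> 'b \<Rightarrow> complex" where
  "DL_walk_op q r V G1 G2 f =
     (\<lambda>x. if x \<in> V then 1 / of_nat (q + r) * (\<Sum>y | y \<in> V \<and> DL_adj G1 G2 x y. f y) else 0)"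

definition plancherel_measure ::
    "'v set \<Rightarrow> (real set \<Rightarrow> ('v \<Rightarrow> complex) \<Rightarrow> ('v \<Rightarrow> complex)) \<Rightarrow> 'v \<Rightarrow> real measure" where
  "plancherel_measure V E v = spectral_measure V E (delta_fun v)"

definition DL_eigenvalue :: "nat \<Rightarrow> nat \<Rightarrow> nat \<Rightarrow> nat \<Rightarrow> real" where
  "DL_eigenvalue q r m n =
     2 * sqrt (real (q * r)) / real (q + r) * cos (real m / real n * pi)"

end

theory Submission
  imports Defs
begin

text \<open>The proof exhibits enough finitely supported eigenfunctions of the walk to account for the
  whole mass of \<open>\<delta>\<^sub>o\<close>.

  An end of a homogeneous tree gives every vertex a parent, one level closer to the end, so that
  the Busemann function is a level function and each vertex has \<open>q\<close> (in the second tree \<open>r\<close>)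
  children (\<open>homogeneous_tree_parent\<close>). Neighbours in the Diestel--Leader graph move to a child in
  one tree and to the parent in the other.

  Let \<open>a\<^sub>1\<close> be the ancestor of \<open>o\<^sub>1\<close> that is \<open>i \<ge> 1\<close> generations above it and \<open>a\<^sub>2\<close> the ancestor of
  \<open>o\<^sub>2\<close> that is \<open>j \<ge> 1\<close> generations above it, and put \<open>n = i + j\<close>. On the vertices below \<open>a\<^sub>1\<close> let \<open>\<alpha>\<close> be the
  indicator of the branch containing \<open>o\<^sub>1\<close> minus its average over the branches, and let \<open>\<beta>\<close> be the
  analogous function below \<open>a\<^sub>2\<close>. Since \<open>\<alpha>\<close> sums to zero over the children of \<open>a\<^sub>1\<close> and is constant
  on siblings further down, the functions \<open>\<alpha>(x\<^sub>1) \<beta>(x\<^sub>2) g(level x\<^sub>1)\<close> form an invariant space of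
  dimension \<open>n - 1\<close>, on which the walk is, after rescaling, \<open>sqrt (q r) / (q + r)\<close> times the
  adjacency matrix of a path. Its eigenvalues are \<open>\<lambda>\<^bsub>m,n\<^esub>\<close> for \<open>1 \<le> m < n\<close>, with sine waves as
  eigenvectors (\<open>eigenfun_neighbour_sum\<close>). The spaces for different \<open>(i, j)\<close> are orthogonal
  (\<open>eigenfun_orthogonal\<close>), and the component of \<open>\<delta>\<^sub>o\<close> along such an eigenfunction has square norm
  \<open>(q - 1) (r - 1) q\<^sup>-\<^sup>i r\<^sup>-\<^sup>j (2 / n) sin\<^sup>2 (\<pi> m i / n)\<close> (\<open>eigenfun_weight\<close>).

  An eigenfunction with eigenvalue \<open>\<lambda>\<close> is fixed by the spectral projection \<open>E {\<lambda>}\<close>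
  (\<open>spectral_projection_eigenfunction\<close>), so Bessel's inequality turns these numbers into lower
  bounds for the atoms of \<open>\<mu>\<close> (\<open>atom_lower_bound\<close>). Over \<open>m\<close> they add up to
  \<open>(q - 1) (r - 1) q\<^sup>-\<^sup>i r\<^sup>-\<^sup>j\<close>, and over all \<open>i, j \<ge> 1\<close> to one
  (\<open>sum_weight_tendsto_1\<close>). As \<open>\<mu>\<close> has total mass one, the bounds are equalities and nothing is left
  outside the atoms (\<open>exhausted_by_atoms\<close>).

  For coprime \<open>m\<close> and \<open>n\<close> the eigenvalue \<open>\<lambda>\<^bsub>m,n\<^esub>\<close> arises from the pairs \<open>(k m, k n)\<close> with
  \<open>k \<ge> 1\<close>. For fixed \<open>k\<close> the sum over \<open>i\<close> is a geometric sum in \<open>r / q\<close> and \<open>cis\<close>, and the sum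
  over \<open>k\<close> is a logarithmic series, or a geometric one for \<open>r = q\<close>
  (\<open>sum_weight_tendsto_atom_mass\<close>).\<close>

section \<open>Square-summable functions\<close>

definition sqnorm :: "'v set \<Rightarrow> ('v \<Rightarrow> complex) \<Rightarrow> real" where
  "sqnorm V f = (\<Sum>\<^sub>\<infinity>x\<in>V. (cmod (f x))\<^sup>2)"

lemma ell2_inner_self: "ell2_inner V f f = complex_of_real (sqnorm V f)"
proof -
  have "cnj z * z = complex_of_real ((cmod z)\<^sup>2)" for z
    by (metis complex_norm_square mult.commute)
  then have "ell2_inner V f f = (\<Sum>\<^sub>\<infinity>x\<in>V. complex_of_real ((cmod (f x))\<^sup>2))"
    by (simp add: ell2_inner_def)
  also have "\<dots> = complex_of_real (sqnorm V f)"
  proof (cases "(\<lambda>x. (cmod (f x))\<^sup>2) summable_on V")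
    case True
    then show ?thesis
      unfolding sqnorm_def by (intro infsumI has_sum_of_real has_sum_infsum)
  next
    case False
    then have "\<not> (\<lambda>x. complex_of_real ((cmod (f x))\<^sup>2)) summable_on V"
      by (auto dest: summable_on_Re)
    with False show ?thesis unfolding sqnorm_def by (simp add: infsum_not_exists)
  qed
  finally show ?thesis .
qed

lemma sqnorm_nonneg: "sqnorm V f \<ge> 0"
  unfolding sqnorm_def by (rule infsum_nonneg) simp

lemma ell2_inner_commute: "ell2_inner V g f = cnj (ell2_inner V f g)"
  unfolding ell2_inner_def by (simp flip: infsum_cnj add: mult.commute)

lemma ell2_summable_inner:
  assumes "f \<in> ell2 V" "g \<in> ell2 V"
  shows "(\<lambda>x. cnj (f x) * g x) summable_on V"
proof -
  have "(\<lambda>x. (cmod (f x))\<^sup>2 + (cmod (g x))\<^sup>2) summable_on V"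
    using assms by (auto simp: ell2_def intro: summable_on_add)
  moreover have "norm (cnj (f x) * g x) \<le> (cmod (f x))\<^sup>2 + (cmod (g x))\<^sup>2" for x
  proof -
    have "2 * (cmod (f x) * cmod (g x)) \<le> (cmod (f x))\<^sup>2 + (cmod (g x))\<^sup>2"
      using sum_squares_bound[of "cmod (f x)" "cmod (g x)"] by simp
    moreover have "0 \<le> cmod (f x) * cmod (g x)" by simp
    ultimately show ?thesis unfolding norm_mult complex_mod_cnj by linarith
  qed
  ultimately have "(\<lambda>x. norm (cnj (f x) * g x)) summable_on V"
    by (rule Infinite_Sum.abs_summable_on_comparison_test')
  then show ?thesis by (rule abs_summable_summable)
qed

lemma ell2_lin:
  assumes "f \<in> ell2 V" "g \<in> ell2 V"
  shows "(\<lambda>x. a * f x + b * g x) \<in> ell2 V"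
proof -
  have "(\<lambda>x. 2 * (cmod a)\<^sup>2 * (cmod (f x))\<^sup>2 + 2 * (cmod b)\<^sup>2 * (cmod (g x))\<^sup>2) summable_on V"
    using assms by (auto simp: ell2_def intro!: summable_on_add summable_on_cmult_right)
  moreover have "(cmod (a * f x + b * g x))\<^sup>2
      \<le> 2 * (cmod a)\<^sup>2 * (cmod (f x))\<^sup>2 + 2 * (cmod b)\<^sup>2 * (cmod (g x))\<^sup>2" for x
  proof -
    have "(cmod (a * f x + b * g x))\<^sup>2 \<le> (cmod (a * f x) + cmod (b * g x))\<^sup>2"
      by (intro power_mono norm_triangle_ineq) simp
    also have "\<dots> \<le> 2 * (cmod (a * f x))\<^sup>2 + 2 * (cmod (b * g x))\<^sup>2"
      using sum_squares_bound[of "cmod (a * f x)" "cmod (b * g x)"] by (simp add: power2_sum)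
    finally show ?thesis by (simp add: norm_mult power_mult_distrib)
  qed
  ultimately have "(\<lambda>x. (cmod (a * f x + b * g x))\<^sup>2) summable_on V"
    by (rule summable_on_comparison_test) simp_all
  then show ?thesis using assms by (auto simp: ell2_def)
qed

lemma ell2_inner_lin_right:
  assumes "k \<in> ell2 V" "f \<in> ell2 V" "g \<in> ell2 V"
  shows "ell2_inner V k (\<lambda>x. a * f x + b * g x) = a * ell2_inner V k f + b * ell2_inner V k g"
proof -
  have "ell2_inner V k (\<lambda>x. a * f x + b * g x)
      = (\<Sum>\<^sub>\<infinity>x\<in>V. a * (cnj (k x) * f x) + b * (cnj (k x) * g x))"
    unfolding ell2_inner_def by (rule infsum_cong) (simp add: algebra_simps)
  also have "\<dots> = (\<Sum>\<^sub>\<infinity>x\<in>V. a * (cnj (k x) * f x)) + (\<Sum>\<^sub>\<infinity>x\<in>V. b * (cnj (k x) * g x))"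
    by (intro infsum_add summable_on_cmult_right ell2_summable_inner assms)
  finally show ?thesis
    unfolding ell2_inner_def by (simp add: infsum_cmult_right')
qed

lemma ell2_inner_lin_left:
  assumes "k \<in> ell2 V" "f \<in> ell2 V" "g \<in> ell2 V"
  shows "ell2_inner V (\<lambda>x. a * f x + b * g x) k
    = cnj a * ell2_inner V f k + cnj b * ell2_inner V g k"
  by (subst (1 2 3) ell2_inner_commute) (simp add: ell2_inner_lin_right assms)

lemma ell2_zero_if_sqnorm_zero:
  assumes "f \<in> ell2 V" "sqnorm V f = 0"
  shows "f = (\<lambda>x. 0)"
proof
  fix x show "f x = 0"
  proof (cases "x \<in> V")
    case True
    have "(cmod (f x))\<^sup>2 = 0"
      using assms True unfolding sqnorm_def ell2_def
      by (intro nonneg_infsum_le_0D[where A=V]) auto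
    then show ?thesis by simp
  qed (use assms in \<open>simp add: ell2_def\<close>)
qed

lemma ell2_finite_support:
  assumes "finite S" "S \<subseteq> V" "\<And>x. x \<notin> S \<Longrightarrow> f x = 0"
  shows "f \<in> ell2 V"
proof -
  have "(\<lambda>x. (cmod (f x))\<^sup>2) summable_on S" using assms by simp
  also have "?this \<longleftrightarrow> (\<lambda>x. (cmod (f x))\<^sup>2) summable_on V"
    using assms by (intro summable_on_cong_neutral) auto
  finally show ?thesis using assms by (auto simp: ell2_def)
qed

lemma ell2_inner_finite_support:
  assumes "finite S" "S \<subseteq> V" "\<And>x. x \<notin> S \<Longrightarrow> f x = 0"
  shows "ell2_inner V f g = (\<Sum>x\<in>S. cnj (f x) * g x)"
proof -
  have "ell2_inner V f g = infsum (\<lambda>x. cnj (f x) * g x) S"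
    unfolding ell2_inner_def using assms by (intro infsum_cong_neutral) auto
  then show ?thesis using assms(1) by simp
qed

text \<open>Bessel's inequality, for orthogonal families that need not be normalized: subtracting from
  \<open>u\<close> its component along one \<open>f j\<close> lowers \<open>sqnorm\<close> by exactly the corresponding term and leaves
  the inner products with the others unchanged.\<close>

lemma bessel:
  assumes "finite J"
    and "\<And>j. j \<in> J \<Longrightarrow> f j \<in> ell2 V" "\<And>j. j \<in> J \<Longrightarrow> sqnorm V (f j) > 0"
    and "\<And>j k. j \<in> J \<Longrightarrow> k \<in> J \<Longrightarrow> j \<noteq> k \<Longrightarrow> ell2_inner V (f j) (f k) = 0"
    and "u \<in> ell2 V"
  shows "(\<Sum>j\<in>J. (cmod (ell2_inner V (f j) u))\<^sup>2 / sqnorm V (f j)) \<le> sqnorm V u"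
  using assms
proof (induction J arbitrary: u rule: finite_induct)
  case empty
  then show ?case by (simp add: sqnorm_nonneg)
next
  case (insert j J)
  define c where "c = ell2_inner V (f j) u / sqnorm V (f j)"
  define u' where "u' = (\<lambda>x. 1 * u x + (- c) * f j x)"
  have fj: "f j \<in> ell2 V" and s: "sqnorm V (f j) > 0" using insert.prems by auto
  have u': "u' \<in> ell2 V" unfolding u'_def by (intro ell2_lin insert.prems fj)
  have eq: "ell2_inner V (f k) u' = ell2_inner V (f k) u" if "k \<in> J" for k
  proof -
    have "k \<noteq> j" using that insert.hyps by auto
    then have "ell2_inner V (f k) (f j) = 0" using that insert.prems by auto
    then show ?thesis
      unfolding u'_def using that insert.prems fj by (subst ell2_inner_lin_right) auto
  qed
  have "(\<Sum>k\<in>J. (cmod (ell2_inner V (f k) u'))\<^sup>2 / sqnorm V (f k)) \<le> sqnorm V u'"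
    by (rule insert.IH) (use insert.prems u' in auto)
  then have IH: "(\<Sum>k\<in>J. (cmod (ell2_inner V (f k) u))\<^sup>2 / sqnorm V (f k)) \<le> sqnorm V u'"
    by (simp add: eq)
  have uj: "ell2_inner V u (f j) = cnj c * sqnorm V (f j)"
    using s unfolding c_def by (subst ell2_inner_commute) simp
  have ju: "ell2_inner V (f j) u = c * sqnorm V (f j)" using s unfolding c_def by simp
  have "ell2_inner V u' u' = ell2_inner V u u - c * cnj c * sqnorm V (f j)"
    unfolding u'_def
    by (simp only: ell2_inner_lin_left ell2_inner_lin_right ell2_lin insert.prems(4) fj uj ju
        ell2_inner_self[of V "f j"]) (simp add: algebra_simps)
  then have "complex_of_real (sqnorm V u')
      = complex_of_real (sqnorm V u - (cmod c)\<^sup>2 * sqnorm V (f j))"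
    unfolding ell2_inner_self by (simp flip: complex_norm_square)
  then have "sqnorm V u' = sqnorm V u - (cmod c)\<^sup>2 * sqnorm V (f j)"
    using of_real_eq_iff by blast
  moreover have "(cmod c)\<^sup>2 * sqnorm V (f j) = (cmod (ell2_inner V (f j) u))\<^sup>2 / sqnorm V (f j)"
    using s unfolding c_def by (simp add: norm_divide field_simps power2_eq_square)
  ultimately show ?case using IH insert.hyps by simp
qed

text \<open>Counting the pairs \<open>(x, y)\<close> of neighbours from both ends bounds the square norm of the
  neighbour sums by \<open>d\<^sup>2\<close> times the square norm of the function.\<close>

lemma neighbour_sum_ell2:
  fixes N :: "'v \<Rightarrow> 'v set"
  assumes f: "f \<in> ell2 V"
    and N: "\<And>x. x \<in> V \<Longrightarrow> N x \<subseteq> V \<and> finite (N x) \<and> card (N x) \<le> d"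
    and sym: "\<And>x y. x \<in> V \<Longrightarrow> y \<in> V \<Longrightarrow> y \<in> N x \<longleftrightarrow> x \<in> N y"
  shows "(\<lambda>x. if x \<in> V then c * (\<Sum>y\<in>N x. f y) else 0) \<in> ell2 V"
proof -
  have sf: "(\<lambda>x. (cmod (f x))\<^sup>2) summable_on V" using f by (simp add: ell2_def)
  have "(\<lambda>x. (cmod (\<Sum>y\<in>N x. f y))\<^sup>2) summable_on V"
  proof (rule nonneg_bdd_above_summable_on)
    show "bdd_above (sum (\<lambda>x. (cmod (\<Sum>y\<in>N x. f y))\<^sup>2) ` {F. F \<subseteq> V \<and> finite F})"
    proof (rule bdd_aboveI2)
      fix F assume "F \<in> {F. F \<subseteq> V \<and> finite F}"
      then have F: "F \<subseteq> V" "finite F" by auto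
      define Y where "Y = (\<Union>x\<in>F. N x)"
      have Y: "finite Y" "Y \<subseteq> V" unfolding Y_def using F N by blast+
      have "(\<Sum>x\<in>F. (cmod (\<Sum>y\<in>N x. f y))\<^sup>2) \<le> (\<Sum>x\<in>F. real d * (\<Sum>y\<in>N x. (cmod (f y))\<^sup>2))"
      proof (rule sum_mono)
        fix x assume "x \<in> F"
        then have Nx: "finite (N x)" "card (N x) \<le> d" using F N by auto
        have "(cmod (\<Sum>y\<in>N x. f y))\<^sup>2 \<le> (\<Sum>y\<in>N x. cmod (f y))\<^sup>2"
          by (intro power_mono norm_sum) simp
        also have "\<dots> \<le> real (card (N x)) * (\<Sum>y\<in>N x. (cmod (f y))\<^sup>2)"
          using sum_squared_le_sum_of_squares[of "\<lambda>y. cmod (f y)" "N x"]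
          by (simp add: mult.commute)
        also have "\<dots> \<le> real d * (\<Sum>y\<in>N x. (cmod (f y))\<^sup>2)"
          using Nx by (intro mult_right_mono sum_nonneg) auto
        finally show "(cmod (\<Sum>y\<in>N x. f y))\<^sup>2 \<le> real d * (\<Sum>y\<in>N x. (cmod (f y))\<^sup>2)" .
      qed
      also have "\<dots> = real d * (\<Sum>x\<in>F. \<Sum>y | y \<in> Y \<and> y \<in> N x. (cmod (f y))\<^sup>2)"
        unfolding sum_distrib_left[symmetric]
        by (intro arg_cong2[where f="(*)"] refl sum.cong) (auto simp: Y_def)
      also have "\<dots> = real d * (\<Sum>y\<in>Y. \<Sum>x | x \<in> F \<and> y \<in> N x. (cmod (f y))\<^sup>2)"
        using F Y by (subst sum.swap_restrict) auto
      also have "\<dots> \<le> real d * (\<Sum>y\<in>Y. real d * (cmod (f y))\<^sup>2)"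
      proof (intro mult_left_mono sum_mono)
        fix y assume y: "y \<in> Y"
        have "{x. x \<in> F \<and> y \<in> N x} \<subseteq> N y" using sym y Y F by blast
        then have "card {x. x \<in> F \<and> y \<in> N x} \<le> card (N y)"
          using N y Y by (intro card_mono) auto
        also have "\<dots> \<le> d" using N y Y by auto
        finally show "(\<Sum>x | x \<in> F \<and> y \<in> N x. (cmod (f y))\<^sup>2) \<le> real d * (cmod (f y))\<^sup>2"
          by (simp add: mult_right_mono)
      qed simp
      also have "\<dots> \<le> real d * (real d * (\<Sum>\<^sub>\<infinity>y\<in>V. (cmod (f y))\<^sup>2))"
        unfolding sum_distrib_left[symmetric]
        by (intro mult_left_mono finite_sum_le_infsum sf Y) auto
      finally show "(\<Sum>x\<in>F. (cmod (\<Sum>y\<in>N x. f y))\<^sup>2)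
        \<le> real d * (real d * (\<Sum>\<^sub>\<infinity>y\<in>V. (cmod (f y))\<^sup>2))" .
    qed
  qed simp
  then have "(\<lambda>x. (cmod c)\<^sup>2 * (cmod (\<Sum>y\<in>N x. f y))\<^sup>2) summable_on V"
    by (rule summable_on_cmult_right)
  also have "?this \<longleftrightarrow>
      (\<lambda>x. (cmod (if x \<in> V then c * (\<Sum>y\<in>N x. f y) else 0))\<^sup>2) summable_on V"
    by (intro summable_on_cong) (simp add: norm_mult power_mult_distrib)
  finally show ?thesis by (simp add: ell2_def)
qed

section \<open>Spectral projections of eigenfunctions\<close>

lemma spectral_measure_emeasure:
  assumes E: "resolution_of_identity V E" and f: "f \<in> ell2 V"
  shows "space (spectral_measure V E f) = UNIV"
    and "sets (spectral_measure V E f) = sets borel"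
    and "B \<in> sets borel \<Longrightarrow> emeasure (spectral_measure V E f) B = ennreal (sqnorm V (E B f))"
    and "B \<in> sets borel \<Longrightarrow> ell2_inner V f (E B f) = complex_of_real (sqnorm V (E B f))"
    and "finite_measure (spectral_measure V E f)"
    and "B \<in> sets borel \<Longrightarrow> measure (spectral_measure V E f) B = sqnorm V (E B f)"
proof -
  let ?M = "spectral_measure V E f"
  show sp: "space ?M = UNIV" unfolding spectral_measure_def by (simp add: space_measure_of_conv)
  have sa: "sigma_algebra UNIV (sets borel :: real set set)"
    by (metis sets.sigma_algebra_axioms space_borel)
  show st: "sets ?M = sets borel" unfolding spectral_measure_def
    using sigma_algebra.sets_measure_of_eq[OF sa] by blast
  show inner: "ell2_inner V f (E B f) = complex_of_real (sqnorm V (E B f))" if "B \<in> sets borel" for B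
  proof -
    have "self_adjoint_projection V (E B)" using E that by (auto simp: resolution_of_identity_def)
    then have "E B f \<in> ell2 V" "E B (E B f) = E B f"
      "ell2_inner V f (E B (E B f)) = ell2_inner V (E B f) (E B f)"
      using f unfolding self_adjoint_projection_def by blast+
    then show ?thesis by (simp add: ell2_inner_self)
  qed
  have "countably_additive (sets borel) (\<lambda>B. ennreal (Re (ell2_inner V f (E B f))))"
    unfolding countably_additive_def
  proof (intro allI impI)
    fix A :: "nat \<Rightarrow> real set"
    assume A: "range A \<subseteq> sets borel" "disjoint_family A" "(\<Union>i. A i) \<in> sets borel"
    have "(\<lambda>n. ell2_inner V f (E (A n) f)) sums ell2_inner V f (E (\<Union>n. A n) f)"
      using E f A unfolding resolution_of_identity_def by blast
    then have "(\<lambda>n. Re (ell2_inner V f (E (A n) f))) sums Re (ell2_inner V f (E (\<Union>n. A n) f))"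
      by (rule sums_Re)
    moreover have "Re (ell2_inner V f (E (A n) f)) \<ge> 0" for n
      using A inner[of "A n"] by (auto simp: sqnorm_nonneg)
    ultimately show "(\<Sum>i. ennreal (Re (ell2_inner V f (E (A i) f))))
        = ennreal (Re (ell2_inner V f (E (\<Union>i. A i) f)))"
      by (intro suminf_ennreal_eq)
  qed
  moreover have "positive (sets borel) (\<lambda>B. ennreal (Re (ell2_inner V f (E B f))))"
    using inner[of "{}"] E f by (simp add: positive_def resolution_of_identity_def ell2_inner_def)
  ultimately show em: "emeasure ?M B = ennreal (sqnorm V (E B f))" if "B \<in> sets borel" for B
    using that inner[OF that] unfolding spectral_measure_def
    by (subst emeasure_measure_of_sigma[OF sa]) (auto simp: sqnorm_nonneg)
  show fin: "finite_measure ?M" by (rule finite_measureI) (simp add: sp em)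
  show "measure ?M B = sqnorm V (E B f)" if "B \<in> sets borel" for B
    unfolding measure_def em[OF that] by (simp add: sqnorm_nonneg)
qed

lemma
  assumes E: "resolution_of_identity V E" and B: "B \<in> sets borel" and f: "f \<in> ell2 V"
  shows resolution_ell2: "E B f \<in> ell2 V"
    and resolution_lin: "g \<in> ell2 V \<Longrightarrow>
      E B (\<lambda>x. a * f x + b * g x) = (\<lambda>x. a * E B f x + b * E B g x)"
    and resolution_self_adjoint: "g \<in> ell2 V \<Longrightarrow>
      ell2_inner V f (E B g) = ell2_inner V (E B f) g"
    and resolution_mult: "C \<in> sets borel \<Longrightarrow> E C (E B f) = E (C \<inter> B) f"
proof -
  have "\<forall>B\<in>sets borel. self_adjoint_projection V (E B)"
    using E unfolding resolution_of_identity_def by (elim conjE)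
  then have sa: "self_adjoint_projection V (E B)" using B by blast
  have m: "\<forall>A\<in>sets borel. \<forall>B\<in>sets borel. \<forall>f\<in>ell2 V. E (A \<inter> B) f = E A (E B f)"
    using E unfolding resolution_of_identity_def by (elim conjE)
  show "E B f \<in> ell2 V" using sa f by (simp add: self_adjoint_projection_def)
  show "E B (\<lambda>x. a * f x + b * g x) = (\<lambda>x. a * E B f x + b * E B g x)" if "g \<in> ell2 V"
    using sa f that by (simp add: self_adjoint_projection_def)
  show "ell2_inner V f (E B g) = ell2_inner V (E B f) g" if "g \<in> ell2 V"
    using sa f that by (simp add: self_adjoint_projection_def)
  show "E C (E B f) = E (C \<inter> B) f" if "C \<in> sets borel"
    using m that B f by simp
qed

text \<open>Splitting \<open>f\<close> into \<open>g = E(A)f\<close> and \<open>h = f - g\<close> block-diagonalizes the form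
  \<open>\<langle>f, T f\<rangle>\<close>: for \<open>|c| = 1\<close> the function \<open>g + c h\<close> has the same spectral measure as \<open>f\<close>, so
  \<open>\<langle>g + c h, T (g + c h)\<rangle>\<close> does not depend on \<open>c\<close>, and comparing \<open>c = 1\<close>, \<open>c = -1\<close> and \<open>c = \<i>\<close>
  shows \<open>\<langle>g, T h\<rangle> = 0\<close>.\<close>

lemma spectral_inner_restrict:
  assumes SR: "spectral_resolution V T E"
    and Tlin: "\<And>f g a b. f \<in> ell2 V \<Longrightarrow> g \<in> ell2 V \<Longrightarrow>
      T (\<lambda>x. a * f x + b * g x) = (\<lambda>x. a * T f x + b * T g x)"
    and Tell: "\<And>f. f \<in> ell2 V \<Longrightarrow> T f \<in> ell2 V"
    and f: "f \<in> ell2 V" and A: "A \<in> sets borel"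
  shows "ell2_inner V (E A f) (T f)
    = complex_of_real (\<integral>t. indicator A t * t \<partial>spectral_measure V E f)"
proof -
  have E: "resolution_of_identity V E" using SR by (simp add: spectral_resolution_def)
  note Eell = resolution_ell2[OF E] and Elin = resolution_lin[OF E]
    and Esa = resolution_self_adjoint[OF E] and Emult = resolution_mult[OF E]
  define g where "g = E A f"
  define h where "h = (\<lambda>x. 1 * f x + (- 1) * g x)"
  have g: "g \<in> ell2 V" unfolding g_def by (intro Eell f A)
  have h: "h \<in> ell2 V" unfolding h_def by (intro ell2_lin f g)
  have Ag: "E A g = g" unfolding g_def by (simp add: Emult f A)
  have Ah: "E A h = (\<lambda>x. 0)"
    unfolding h_def by (subst Elin[OF A f g]) (simp add: Ag, simp add: g_def)
  have f_eq: "f = (\<lambda>x. 1 * g x + 1 * h x)" unfolding h_def by simp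
  have cross: "ell2_inner V g (E B h) = 0" "ell2_inner V h (E B g) = 0"
    if B: "B \<in> sets borel" for B
  proof -
    have "ell2_inner V g (E B h) = ell2_inner V (E A g) (E B h)" by (simp add: Ag)
    also have "\<dots> = ell2_inner V g (E (A \<inter> B) h)"
      by (simp add: Esa[symmetric] Emult g h A B Eell)
    also have "E (A \<inter> B) h = E B (E A h)" by (simp add: Emult h A B Int_commute)
    also have "E B (E A h) = (\<lambda>x. 0)"
    proof -
      have "E B (\<lambda>x. 0) = E B (\<lambda>x. 0 * h x + 0 * h x)" by simp
      also have "\<dots> = (\<lambda>x. 0)" by (subst Elin[OF B h h]) simp
      finally show ?thesis by (simp add: Ah)
    qed
    finally show *: "ell2_inner V g (E B h) = 0" by (simp add: ell2_inner_def)
    have "ell2_inner V h (E B g) = ell2_inner V (E B h) g" by (rule Esa[OF B h g])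
    also have "\<dots> = cnj (ell2_inner V g (E B h))" by (rule ell2_inner_commute)
    finally show "ell2_inner V h (E B g) = 0" using * by simp
  qed
  note sm = spectral_measure_emeasure[OF E]
  have form: "ell2_inner V k (T k) = complex_of_real (\<integral>t. t \<partial>spectral_measure V E k)"
    "integrable (spectral_measure V E k) (\<lambda>t. t)" if "k \<in> ell2 V" for k
    using SR that by (auto simp: spectral_resolution_def)
  have fB: "ell2_inner V (\<lambda>x. 1 * g x + c * h x) (E B (\<lambda>x. 1 * g x + c * h x))
      = ell2_inner V g (E B g) + c * cnj c * ell2_inner V h (E B h)" if "B \<in> sets borel" for B c
    by (simp only: Elin ell2_inner_lin_left ell2_inner_lin_right ell2_lin that Eell g h cross)
       (simp add: algebra_simps)
  have same: "spectral_measure V E (\<lambda>x. 1 * g x + c * h x) = spectral_measure V E f"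
    if "c * cnj c = 1" for c
  proof (rule measure_eqI)
    let ?k = "\<lambda>x. 1 * g x + c * h x"
    have k: "?k \<in> ell2 V" by (intro ell2_lin g h)
    show "sets (spectral_measure V E ?k) = sets (spectral_measure V E f)"
      by (simp only: sm(2)[OF k] sm(2)[OF f])
    fix B assume "B \<in> sets (spectral_measure V E ?k)"
    then have B: "B \<in> sets borel" by (simp only: sm(2)[OF k])
    have "complex_of_real (sqnorm V (E B ?k)) = ell2_inner V ?k (E B ?k)"
      by (rule sm(4)[OF k B, symmetric])
    also have "\<dots> = ell2_inner V g (E B g) + ell2_inner V h (E B h)"
      using fB[OF B, of c] that by simp
    also have "\<dots> = ell2_inner V (\<lambda>x. 1 * g x + 1 * h x) (E B (\<lambda>x. 1 * g x + 1 * h x))"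
      by (simp only: fB[OF B, of 1]) simp
    also have "\<dots> = ell2_inner V f (E B f)" by (simp only: f_eq[symmetric])
    also have "\<dots> = complex_of_real (sqnorm V (E B f))" by (rule sm(4)[OF f B])
    finally show "emeasure (spectral_measure V E ?k) B = emeasure (spectral_measure V E f) B"
      unfolding of_real_eq_iff by (simp only: sm(3)[OF k B] sm(3)[OF f B])
  qed
  have Tform: "ell2_inner V g (T g) + c * cnj c * ell2_inner V h (T h)
      + c * ell2_inner V g (T h) + cnj c * ell2_inner V h (T g) = ell2_inner V f (T f)"
    if "c * cnj c = 1" for c
  proof -
    let ?k = "\<lambda>x. 1 * g x + c * h x"
    have k: "?k \<in> ell2 V" by (intro ell2_lin g h)
    have "ell2_inner V ?k (T ?k) = ell2_inner V g (T g) + c * cnj c * ell2_inner V h (T h)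
      + c * ell2_inner V g (T h) + cnj c * ell2_inner V h (T g)"
      by (simp only: Tlin ell2_inner_lin_left ell2_inner_lin_right ell2_lin Tell g h)
         (simp add: algebra_simps)
    moreover have "ell2_inner V ?k (T ?k) = ell2_inner V f (T f)"
      unfolding form(1)[OF k] form(1)[OF f] same[OF that] by simp
    ultimately show ?thesis by simp
  qed
  have p1: "ell2_inner V g (T g) + ell2_inner V h (T h)
      + ell2_inner V g (T h) + ell2_inner V h (T g) = ell2_inner V f (T f)"
    using Tform[of 1] by simp
  have m1: "ell2_inner V g (T g) + ell2_inner V h (T h)
      - ell2_inner V g (T h) - ell2_inner V h (T g) = ell2_inner V f (T f)"
    using Tform[of "-1"] by simp
  have i1: "ell2_inner V g (T g) + ell2_inner V h (T h)
      + \<i> * ell2_inner V g (T h) - \<i> * ell2_inner V h (T g) = ell2_inner V f (T f)"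
    using Tform[of "\<i>"] by simp
  have "x = 0" if "a + x + y = c" "a - x - y = c" "a + \<i> * x - \<i> * y = c" for a c x y :: complex
  proof -
    have "Re x = 0 \<and> Im x = 0" using that by (auto simp: complex_eq_iff)
    then show ?thesis by (simp add: complex_eq_iff)
  qed
  from this[OF p1 m1 i1] have gTh: "ell2_inner V g (T h) = 0" .
  have "ell2_inner V g (T f) = ell2_inner V g (T g) + ell2_inner V g (T h)"
    using ell2_inner_lin_right[OF g Tell[OF g] Tell[OF h], of 1 1]
    by (simp only: Tlin[OF g h, of 1 1, folded f_eq]) simp
  also have "\<dots> = complex_of_real (\<integral>t. t \<partial>spectral_measure V E g)"
    by (simp add: gTh form(1)[OF g])
  also have "spectral_measure V E g = density (spectral_measure V E f) (indicator A)"
  proof (rule measure_eqI)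
    show "sets (spectral_measure V E g) = sets (density (spectral_measure V E f) (indicator A))"
      by (simp add: sm(2) f g)
    fix B assume "B \<in> sets (spectral_measure V E g)"
    then have B: "B \<in> sets borel" by (simp add: sm(2) g)
    have "emeasure (density (spectral_measure V E f) (indicator A)) B
        = emeasure (spectral_measure V E f) (A \<inter> B)"
      using A B by (intro emeasure_restricted) (simp_all add: sm(2) f)
    moreover have "E B g = E (A \<inter> B) f" unfolding g_def by (simp add: Emult f A B Int_commute)
    ultimately show "emeasure (spectral_measure V E g) B
        = emeasure (density (spectral_measure V E f) (indicator A)) B"
      using A B by (simp add: sm(3) f g)
  qed
  also have "(\<integral>t. t \<partial>density (spectral_measure V E f) (indicator A))
      = (\<integral>t. indicator A t * t \<partial>spectral_measure V E f)"
    (is "?l = ?r")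
  proof -
    have [measurable_cong]: "sets (spectral_measure V E f) = sets borel" by (rule sm(2)[OF f])
    have [measurable]: "A \<in> sets borel" by (rule A)
    have "?l = (\<integral>t. t \<partial>density (spectral_measure V E f) (\<lambda>t. ennreal (indicator A t)))"
      by (simp add: ennreal_indicator)
    also have "\<dots> = ?r" by (subst integral_density) auto
    finally show ?thesis .
  qed
  finally show ?thesis unfolding g_def .
qed

text \<open>The spectral measure of an eigenfunction gives no mass to either side of the eigenvalue:
  on \<open>A = (\<lambda>, \<infinity>)\<close> or \<open>A = (-\<infinity>, \<lambda>)\<close> the integral of the nonzero function \<open>t - \<lambda>\<close>, which has
  constant sign there, vanishes.\<close>

lemma spectral_projection_eigenfunction:
  assumes SR: "spectral_resolution V T E"
    and Tlin: "\<And>f g a b. f \<in> ell2 V \<Longrightarrow> g \<in> ell2 V \<Longrightarrow>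
      T (\<lambda>x. a * f x + b * g x) = (\<lambda>x. a * T f x + b * T g x)"
    and Tell: "\<And>f. f \<in> ell2 V \<Longrightarrow> T f \<in> ell2 V"
    and f: "f \<in> ell2 V" and eig: "T f = (\<lambda>x. complex_of_real l * f x)"
  shows "E {l} f = f"
proof -
  have E: "resolution_of_identity V E" using SR by (simp add: spectral_resolution_def)
  note Eell = resolution_ell2[OF E]
  note sm = spectral_measure_emeasure[OF E f]
  let ?M = "spectral_measure V E f"
  interpret M: finite_measure ?M by (rule sm(5))
  have int: "integrable ?M (\<lambda>t. t)" using SR f by (simp add: spectral_resolution_def)
  have [measurable_cong]: "sets ?M = sets borel" by (rule sm(2))
  have null: "emeasure ?M A = 0"
    if A: "A \<in> sets borel" and sign: "\<And>t. t \<in> A \<Longrightarrow> s * (t - l) > 0" for A s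
  proof -
    have [measurable]: "A \<in> sets borel" by (rule A)
    have iA: "integrable ?M (\<lambda>t. indicator A t * t)"
      using int by (rule integrable_mult_indicator[of A ?M "\<lambda>t. t", simplified])
    have iA1: "integrable ?M (\<lambda>t. indicator A t * l)"
      by (intro integrable_mult_left integrable_real_indicator) (simp_all add: sm(2) M.emeasure_finite less_top[symmetric])
    have "complex_of_real (\<integral>t. indicator A t * t \<partial>?M) = ell2_inner V (E A f) (T f)"
      by (rule spectral_inner_restrict[OF SR Tlin Tell f A, symmetric])
    also have "\<dots> = complex_of_real l * ell2_inner V (E A f) f"
      unfolding eig using ell2_inner_lin_right[OF Eell[OF A f] f f, of l 0] by simp
    also have "ell2_inner V (E A f) f = complex_of_real (sqnorm V (E A f))"
      using sm(4)[OF A] ell2_inner_commute[of V "E A f" f] by simp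
    also have "sqnorm V (E A f) = measure ?M A" using sm(6)[OF A] by simp
    finally have "complex_of_real (\<integral>t. indicator A t * t \<partial>?M) = complex_of_real (l * measure ?M A)"
      by simp
    then have "(\<integral>t. indicator A t * t \<partial>?M) = l * measure ?M A" by (simp only: of_real_eq_iff)
    then have "(\<integral>t. s * (indicator A t * t - indicator A t * l) \<partial>?M) = 0"
      using iA iA1 by (simp add: sm(1))
    moreover have "integrable ?M (\<lambda>t. s * (indicator A t * t - indicator A t * l))"
      using iA iA1 by simp
    moreover have "0 \<le> s * (indicator A t * t - indicator A t * l)" for t
      using sign[of t] by (cases "t \<in> A") auto
    ultimately have "AE t in ?M. s * (indicator A t * t - indicator A t * l) = 0"
      by (subst (asm) integral_nonneg_eq_0_iff_AE) auto
    then have "AE t in ?M. t \<notin> A"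
      by eventually_elim (use sign in \<open>force split: split_indicator_asm\<close>)
    then show ?thesis
      by (subst (asm) AE_iff_measurable[OF _ refl]) (simp_all add: sm(1) sm(2))
  qed
  have "emeasure ?M {l<..} = 0" by (rule null[where s=1]) auto
  moreover have "emeasure ?M {..<l} = 0" by (rule null[where s="-1"]) auto
  ultimately have "emeasure ?M ({..<l} \<union> {l<..}) = 0"
    by (intro emeasure_Un_null_set[THEN trans]) (auto simp: null_sets_def sm(2))
  moreover have "({..<l} \<union> {l<..}) = - {l}" by auto
  ultimately have n: "emeasure ?M (- {l}) = 0" by simp
  have "emeasure ?M UNIV = emeasure ?M {l} + emeasure ?M (- {l})"
    by (subst plus_emeasure) (auto simp: sm(2))
  with n have "sqnorm V (E {l} f) = sqnorm V (E UNIV f)"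
    by (simp add: sm(3) sqnorm_nonneg)
  also have "E UNIV f = f" using E f by (simp add: resolution_of_identity_def)
  finally have sq: "sqnorm V (E {l} f) = sqnorm V f" .
  have fE: "ell2_inner V f (E {l} f) = complex_of_real (sqnorm V f)"
    using sm(4)[of "{l}"] sq by simp
  define k where "k = (\<lambda>x. 1 * E {l} f x + (-1) * f x)"
  have Ef: "E {l} f \<in> ell2 V" by (intro Eell f) simp
  have k: "k \<in> ell2 V" unfolding k_def by (intro ell2_lin f Ef)
  have "ell2_inner V k k = 0"
    unfolding k_def
    by (simp only: ell2_inner_lin_left ell2_inner_lin_right ell2_lin f Ef
        ell2_inner_self[of V f] ell2_inner_self[of V "E {l} f"] sq fE
        ell2_inner_commute[of V "E {l} f" f]) simp
  then have "k = (\<lambda>x. 0)" using k by (intro ell2_zero_if_sqnorm_zero) (auto simp: ell2_inner_self)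
  then show ?thesis unfolding k_def by (auto simp: fun_eq_iff)
qed

text \<open>Bessel's inequality for the projection \<open>E {l} u\<close>, which has the same inner products with
  eigenfunctions to the eigenvalue \<open>l\<close> as \<open>u\<close> itself.\<close>

lemma spectral_atom_lower_bound:
  assumes SR: "spectral_resolution V T E"
    and Tlin: "\<And>f g a b. f \<in> ell2 V \<Longrightarrow> g \<in> ell2 V \<Longrightarrow>
      T (\<lambda>x. a * f x + b * g x) = (\<lambda>x. a * T f x + b * T g x)"
    and Tell: "\<And>f. f \<in> ell2 V \<Longrightarrow> T f \<in> ell2 V"
    and J: "finite J" "\<And>j. j \<in> J \<Longrightarrow> f j \<in> ell2 V" "\<And>j. j \<in> J \<Longrightarrow> sqnorm V (f j) > 0"
      "\<And>j k. j \<in> J \<Longrightarrow> k \<in> J \<Longrightarrow> j \<noteq> k \<Longrightarrow> ell2_inner V (f j) (f k) = 0"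
    and eig: "\<And>j. j \<in> J \<Longrightarrow> T (f j) = (\<lambda>x. complex_of_real l * f j x)"
    and u: "u \<in> ell2 V"
  shows "(\<Sum>j\<in>J. (cmod (ell2_inner V (f j) u))\<^sup>2 / sqnorm V (f j))
    \<le> measure (spectral_measure V E u) {l}"
proof -
  have E: "resolution_of_identity V E" using SR by (simp add: spectral_resolution_def)
  have "ell2_inner V (f j) (E {l} u) = ell2_inner V (f j) u" if "j \<in> J" for j
  proof -
    have "ell2_inner V (f j) (E {l} u) = ell2_inner V (E {l} (f j)) u"
      using J(2)[OF that] u by (intro resolution_self_adjoint[OF E]) simp_all
    also have "E {l} (f j) = f j"
      by (rule spectral_projection_eigenfunction[OF SR Tlin Tell J(2)[OF that] eig[OF that]])
    finally show ?thesis .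
  qed
  moreover have "E {l} u \<in> ell2 V" using u by (intro resolution_ell2[OF E]) simp_all
  ultimately have "(\<Sum>j\<in>J. (cmod (ell2_inner V (f j) u))\<^sup>2 / sqnorm V (f j)) \<le> sqnorm V (E {l} u)"
    using bessel[of J f V "E {l} u"] J by simp
  also have "\<dots> = measure (spectral_measure V E u) {l}"
    using spectral_measure_emeasure(6)[OF E u, of "{l}"] by simp
  finally show ?thesis .
qed

section \<open>Distances in a tree\<close>

lemma rtranclp_distinct_path:
  assumes "R\<^sup>*\<^sup>* a b"
  shows "\<exists>xs. xs \<noteq> [] \<and> hd xs = a \<and> last xs = b \<and> distinct xs \<and> successively R xs"
  using assms
proof (induction rule: converse_rtranclp_induct)
  case base
  show ?case by (rule exI[of _ "[b]"]) simp
next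
  case (step a c)
  then obtain xs where xs: "xs \<noteq> []" "hd xs = c" "last xs = b" "distinct xs" "successively R xs"
    by blast
  show ?case
  proof (cases "a \<in> set xs")
    case False
    then show ?thesis
      using xs step.hyps by (intro exI[of _ "a # xs"]) (auto simp: successively_Cons)
  next
    case True
    then obtain us vs where "xs = us @ a # vs" by (auto simp: in_set_conv_decomp)
    then show ?thesis
      using xs by (intro exI[of _ "a # vs"]) (auto simp: successively_append_iff)
  qed
qed

lemma successively_notin:
  assumes "successively (\<lambda>u v. G u v \<and> u \<noteq> x \<and> v \<noteq> x) xs" "xs \<noteq> []" "hd xs \<noteq> x"
  shows "x \<notin> set xs"
  using assms
proof (induction xs rule: induct_list012)
  case (3 a b xs)
  then show ?case by auto
qed simp_all

locale tree =
  fixes G :: "'a \<Rightarrow> 'a \<Rightarrow> bool"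
  assumes is_tree: "is_tree G"
begin

abbreviation d :: "'a \<Rightarrow> 'a \<Rightarrow> nat" where "d \<equiv> graph_dist G"

lemma adj_sym: "G x y \<Longrightarrow> G y x"
  using is_tree unfolding is_tree_def by (elim conjE) (rule sympD)

lemma adj_irrefl: "\<not> G x x"
  using is_tree unfolding is_tree_def by (elim conjE) (rule irreflpD)

lemma dist_walk: "(G ^^ d x y) x y"
proof -
  have "G\<^sup>*\<^sup>* x y" using is_tree by (simp add: is_tree_def)
  then obtain n where "(G ^^ n) x y" by (blast dest: rtranclp_imp_relpowp)
  then show ?thesis unfolding graph_dist_def by (rule LeastI)
qed

lemma dist_le: "(G ^^ n) x y \<Longrightarrow> d x y \<le> n"
  unfolding graph_dist_def by (rule Least_le)

lemma dist_eq_0_iff: "d x y = 0 \<longleftrightarrow> x = y"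
  using dist_walk[of x y] dist_le[of 0 x y] by auto

lemma dist_triangle: "d x z \<le> d x y + d y z"
proof (rule dist_le)
  show "(G ^^ (d x y + d y z)) x z"
    unfolding relpowp_add by (rule relcomppI[where b = y]) (rule dist_walk)+
qed

lemma dist_adj_le: "G x y \<Longrightarrow> d x z \<le> d y z + 1"
  using dist_le[OF relpowp_Suc_I2[OF _ dist_walk[of y z]], of x] by simp

lemma dist_step:
  assumes "x \<noteq> z"
  shows "\<exists>y. G x y \<and> d x z = d y z + 1"
proof -
  obtain n where n: "d x z = Suc n" using assms dist_eq_0_iff[of x z] by (cases "d x z") auto
  then have "(G ^^ Suc n) x z" using dist_walk[of x z] by simp
  then obtain y where y: "G x y" "(G ^^ n) y z" by (blast dest: relpowp_Suc_D2)
  with n dist_le[OF y(2)] dist_adj_le[OF y(1), of z] show ?thesis by (intro exI[of _ y]) auto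
qed

text \<open>A path between two neighbours of \<open>x\<close> that avoids \<open>x\<close> would close up to a cycle.\<close>

lemma neighbours_separated:
  assumes "G x y" "G x y'" and conn: "(\<lambda>u v. G u v \<and> u \<noteq> x \<and> v \<noteq> x)\<^sup>*\<^sup>* y y'"
  shows "y = y'"
proof (rule ccontr)
  assume ne: "y \<noteq> y'"
  obtain xs where xs: "xs \<noteq> []" "hd xs = y" "last xs = y'" "distinct xs"
    "successively (\<lambda>u v. G u v \<and> u \<noteq> x \<and> v \<noteq> x) xs"
    using rtranclp_distinct_path[OF conn] by blast
  have "y \<noteq> x" using assms adj_irrefl by auto
  then have "x \<notin> set xs" using xs successively_notin[of G x xs] by auto
  moreover have "successively G xs" by (rule successively_mono[OF xs(5)]) auto
  moreover have "length xs \<ge> 2" using xs ne by (cases xs; cases "tl xs") auto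
  ultimately have "graph_cycle G (x # xs)"
    using xs assms adj_sym unfolding graph_cycle_def graph_path_def
    by (auto simp: successively_Cons)
  then show False using is_tree unfolding is_tree_def by blast
qed

lemma geodesic_avoids:
  assumes "d u z < d x z"
  shows "(\<lambda>u v. G u v \<and> u \<noteq> x \<and> v \<noteq> x)\<^sup>*\<^sup>* u z"
  using assms
proof (induction "d u z" arbitrary: u)
  case 0
  then show ?case by (simp add: dist_eq_0_iff)
next
  case (Suc n)
  then obtain v where v: "G u v" "d u z = d v z + 1" using dist_step[of u z] dist_eq_0_iff[of u z] by auto
  then have "(\<lambda>u v. G u v \<and> u \<noteq> x \<and> v \<noteq> x)\<^sup>*\<^sup>* v z" using Suc by auto
  moreover have "u \<noteq> x" "v \<noteq> x" using Suc v by auto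
  ultimately show ?case using v(1) by (simp add: converse_rtranclp_into_rtranclp)
qed

lemma separated_towards:
  assumes "G x y" "G x y'"
    and y: "(\<lambda>u v. G u v \<and> u \<noteq> x \<and> v \<noteq> x)\<^sup>*\<^sup>* y z"
    and y': "(\<lambda>u v. G u v \<and> u \<noteq> x \<and> v \<noteq> x)\<^sup>*\<^sup>* y' z"
  shows "y = y'"
proof -
  let ?R = "\<lambda>u v. G u v \<and> u \<noteq> x \<and> v \<noteq> x"
  have "symp ?R" using adj_sym by (auto simp: symp_def)
  then have "?R\<^sup>*\<^sup>* z y'" using y' by (metis (no_types, lifting) symp_rtranclp sympD)
  with y have "?R\<^sup>*\<^sup>* y y'" by (rule rtranclp_trans)
  then show ?thesis by (rule neighbours_separated[OF assms(1,2)])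
qed

lemma closer_neighbour_unique:
  assumes "G x y" "G x y'" "d y z < d x z" "d y' z < d x z"
  shows "y = y'"
  using assms by (intro separated_towards[of x y y' z] geodesic_avoids)

lemma adj_dist_cases:
  assumes xy: "G x y"
  shows "d x z = d y z + 1 \<or> d y z = d x z + 1"
proof (rule ccontr)
  assume "\<not> ?thesis"
  then have eq: "d x z = d y z"
    using dist_adj_le[OF xy, of z] dist_adj_le[OF adj_sym[OF xy], of z] by linarith
  have "x \<noteq> y" using xy adj_irrefl by auto
  then have "x \<noteq> z" "y \<noteq> z" using eq dist_eq_0_iff by metis+
  then obtain x' y' where x': "G x x'" "d x z = d x' z + 1" and y': "G y y'" "d y z = d y' z + 1"
    using dist_step by meson
  have "y' \<noteq> x" using y' eq by auto
  with \<open>x \<noteq> y\<close> y' have "(\<lambda>u v. G u v \<and> u \<noteq> x \<and> v \<noteq> x) y y'" by auto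
  moreover have "(\<lambda>u v. G u v \<and> u \<noteq> x \<and> v \<noteq> x)\<^sup>*\<^sup>* y' z"
    using y' eq by (intro geodesic_avoids) simp
  ultimately have "(\<lambda>u v. G u v \<and> u \<noteq> x \<and> v \<noteq> x)\<^sup>*\<^sup>* y z"
    by (rule converse_rtranclp_into_rtranclp)
  moreover have "(\<lambda>u v. G u v \<and> u \<noteq> x \<and> v \<noteq> x)\<^sup>*\<^sup>* x' z"
    using x' by (intro geodesic_avoids) simp
  ultimately have "y = x'" using separated_towards[OF xy x'(1)] by blast
  then show False using eq x' by simp
qed

end

section \<open>Parents and levels with respect to an end\<close>

text \<open>A ray \<open>\<xi>\<close> representing the end assigns to each vertex \<open>x\<close> the eventual value of
  \<open>d(x, \<xi>(m)) - m\<close>. Along an edge it changes by exactly one, and each vertex has exactly one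
  neighbour on which it is smaller, its parent; iterating the parent map traces the ray that
  starts at \<open>x\<close> and represents the end.\<close>

locale rayed_tree = tree G for G :: "'a \<Rightarrow> 'a \<Rightarrow> bool" +
  fixes \<xi> :: "nat \<Rightarrow> 'a"
  assumes ray: "\<xi> \<in> geodesic_rays G"
begin

definition level :: "'a \<Rightarrow> int" where
  "level x = (SOME c. \<exists>n. \<forall>m\<ge>n. int (d x (\<xi> m)) = c + int m)"

definition parent :: "'a \<Rightarrow> 'a" where
  "parent x = (THE y. G x y \<and> level y = level x - 1)"

lemma ray_dist: "i \<le> j \<Longrightarrow> d (\<xi> i) (\<xi> j) = j - i"
  using ray by (simp add: geodesic_rays_def)

lemma level_eventually: "\<exists>n. \<forall>m\<ge>n. int (d x (\<xi> m)) = level x + int m"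
proof -
  let ?D = "\<lambda>m. int (d x (\<xi> m)) - int m"
  have low: "?D m + int (d (\<xi> 0) x) \<ge> 0" for m
    using dist_triangle[of "\<xi> 0" "\<xi> m" x] ray_dist[of 0 m] by simp
  have dec: "?D m \<le> ?D n" if "n \<le> m" for m n
    using dist_triangle[of x "\<xi> m" "\<xi> n"] ray_dist[OF that] that by simp
  obtain n where n: "\<And>m. nat (?D n + int (d (\<xi> 0) x)) \<le> nat (?D m + int (d (\<xi> 0) x))"
    using ex_has_least_nat[of "\<lambda>_. True" 0 "\<lambda>m. nat (?D m + int (d (\<xi> 0) x))"] by blast
  have "\<forall>m\<ge>n. int (d x (\<xi> m)) = ?D n + int m"
  proof (intro allI impI)
    fix m assume "n \<le> m"
    then show "int (d x (\<xi> m)) = ?D n + int m"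
      using n[of m] dec[of n m] low[of n] low[of m] by linarith
  qed
  then have "\<exists>c n. \<forall>m\<ge>n. int (d x (\<xi> m)) = c + int m" by blast
  then show ?thesis unfolding level_def by (rule someI_ex)
qed

lemma level_common: "\<exists>m\<ge>k. int (d x (\<xi> m)) = level x + int m \<and> int (d y (\<xi> m)) = level y + int m"
proof -
  obtain n1 n2 where "\<forall>m\<ge>n1. int (d x (\<xi> m)) = level x + int m"
    "\<forall>m\<ge>n2. int (d y (\<xi> m)) = level y + int m" using level_eventually by meson
  then show ?thesis by (intro exI[of _ "max k (max n1 n2)"]) simp
qed

lemma level_lipschitz: "level x - level y \<le> int (d x y)"
proof -
  obtain m where "int (d x (\<xi> m)) = level x + int m" "int (d y (\<xi> m)) = level y + int m"
    using level_common by blast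
  then show ?thesis using dist_triangle[of x "\<xi> m" y] by linarith
qed

lemma level_adj:
  assumes "G x y"
  shows "level x = level y + 1 \<or> level y = level x + 1"
proof -
  obtain m where "int (d x (\<xi> m)) = level x + int m" "int (d y (\<xi> m)) = level y + int m"
    using level_common by blast
  then show ?thesis using adj_dist_cases[OF assms, of "\<xi> m"] by linarith
qed

lemma lower_neighbour_unique:
  assumes "G x y" "level y = level x - 1" "G x y'" "level y' = level x - 1"
  shows "y = y'"
proof -
  obtain n1 n2 n3 where "\<forall>m\<ge>n1. int (d x (\<xi> m)) = level x + int m"
    "\<forall>m\<ge>n2. int (d y (\<xi> m)) = level y + int m" "\<forall>m\<ge>n3. int (d y' (\<xi> m)) = level y' + int m"
    using level_eventually by meson
  then have *: "int (d x (\<xi> m)) = level x + int m" "int (d y (\<xi> m)) = level y + int m"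
    "int (d y' (\<xi> m)) = level y' + int m" if "m = max n1 (max n2 n3)" for m
    using that by simp_all
  show ?thesis
    using assms *[OF refl] by (intro closer_neighbour_unique[of x y y' "\<xi> (max n1 (max n2 n3))"]) linarith+
qed

lemma lower_neighbour_exists: "\<exists>y. G x y \<and> level y = level x - 1"
proof -
  obtain n where n: "\<forall>m\<ge>n. int (d x (\<xi> m)) = level x + int m" using level_eventually by blast
  define k where "k = max n (nat (1 - level x))"
  have k: "int (d x (\<xi> k)) = level x + int k" using n unfolding k_def by simp
  then have "d x (\<xi> k) > 0" unfolding k_def by linarith
  then have "x \<noteq> \<xi> k" using dist_eq_0_iff[of x "\<xi> k"] by auto
  then obtain y where y: "G x y" "d x (\<xi> k) = d y (\<xi> k) + 1" using dist_step by blast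
  obtain m where m: "m \<ge> k" "int (d x (\<xi> m)) = level x + int m" "int (d y (\<xi> m)) = level y + int m"
    using level_common by blast
  have "d y (\<xi> m) \<le> d y (\<xi> k) + (m - k)"
    using dist_triangle[of y "\<xi> m" "\<xi> k"] ray_dist[OF m(1)] by simp
  then have "level y \<le> level x - 1" using m k y by linarith
  then show ?thesis using y(1) level_adj[OF y(1)] by auto
qed

lemma parent: "G x (parent x)" "level (parent x) = level x - 1"
proof -
  have "\<exists>!y. G x y \<and> level y = level x - 1"
    by (rule ex_ex1I[OF lower_neighbour_exists]) (elim conjE, rule lower_neighbour_unique)
  from theI'[OF this] show "G x (parent x)" "level (parent x) = level x - 1"
    unfolding parent_def by simp_all
qed

lemma parent_eqI: "G x y \<Longrightarrow> level y = level x - 1 \<Longrightarrow> parent x = y"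
  by (rule lower_neighbour_unique[OF parent])

lemma adj_iff_parent: "G x y \<longleftrightarrow> y = parent x \<or> x = parent y"
proof
  assume xy: "G x y"
  from level_adj[OF xy] show "y = parent x \<or> x = parent y"
    using parent_eqI[OF xy] parent_eqI[OF adj_sym[OF xy]] by auto
next
  assume "y = parent x \<or> x = parent y"
  then show "G x y" using parent(1)[of x] adj_sym[OF parent(1)[of y]] by auto
qed

lemma level_ancestor: "level ((parent ^^ k) x) = level x - int k"
  by (induction k) (simp_all add: parent)

lemma dist_ancestor: "d x ((parent ^^ k) x) = k"
proof (rule antisym)
  have "(G ^^ k) x ((parent ^^ k) x)"
  proof (induction k)
    case (Suc k)
    then show ?case using parent(1)[of "(parent ^^ k) x"] by auto
  qed simp
  then show "d x ((parent ^^ k) x) \<le> k" by (rule dist_le)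
  show "k \<le> d x ((parent ^^ k) x)"
    using level_lipschitz[of x "(parent ^^ k) x"] by (simp add: level_ancestor)
qed

lemma ancestorI:
  assumes "int (d x z) = level x - level z"
  shows "z = (parent ^^ (d x z)) x"
  using assms
proof (induction "d x z" arbitrary: x)
  case 0
  then have "d x z = 0" by simp
  then show ?case using dist_eq_0_iff[of x z] by simp
next
  case (Suc n)
  then obtain y where y: "G x y" "d x z = d y z + 1"
    using dist_step[of x z] dist_eq_0_iff[of x z] by auto
  have "level y = level x - 1"
    using level_adj[OF y(1)] level_lipschitz[of y z] Suc.prems y(2) by linarith
  then have p: "parent x = y" using y(1) by (intro parent_eqI)
  have "z = (parent ^^ (d y z)) y"
    using Suc.prems Suc.hyps(2) y \<open>level y = level x - 1\<close> by (intro Suc.hyps(1)) auto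
  then show ?case unfolding y(2) using p by (simp add: funpow_swap1)
qed

lemma level_ray: "level (\<xi> n) = - int n"
proof -
  obtain m where "m \<ge> n" "int (d (\<xi> n) (\<xi> m)) = level (\<xi> n) + int m"
    using level_common[of n "\<xi> n" "\<xi> n"] by blast
  then show ?thesis using ray_dist[of n m] by simp
qed

lemma ray_add: "\<xi> (n + i) = (parent ^^ i) (\<xi> n)"
  using ancestorI[of "\<xi> n" "\<xi> (n + i)"] by (simp add: ray_dist level_ray)

lemma ancestor_meets_ray: "\<exists>k n. \<forall>i. (parent ^^ (k + i)) x = \<xi> (n + i)"
proof -
  obtain n where n: "int (d x (\<xi> n)) = level x + int n" using level_common by blast
  then have "\<xi> n = (parent ^^ (d x (\<xi> n))) x" by (intro ancestorI) (simp add: level_ray)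
  then have "(parent ^^ (d x (\<xi> n) + i)) x = \<xi> (n + i)" for i
    unfolding ray_add by (simp add: funpow_add add.commute[of _ i])
  then show ?thesis by blast
qed

abbreviation \<omega> :: "(nat \<Rightarrow> 'a) set" where "\<omega> \<equiv> ray_equiv G `` {\<xi>}"

lemma ancestors_geodesic: "(\<lambda>n. (parent ^^ n) x) \<in> geodesic_rays G"
  unfolding geodesic_rays_def
proof (intro CollectI allI impI)
  fix i j :: nat assume "i \<le> j"
  then have "(parent ^^ j) x = (parent ^^ (j - i)) ((parent ^^ i) x)"
    by (simp flip: funpow_add comp_apply[of "parent ^^ (j - i)"])
  then show "d ((parent ^^ i) x) ((parent ^^ j) x) = j - i" by (simp add: dist_ancestor)
qed

lemma ancestors_in_end: "(\<lambda>n. (parent ^^ n) x) \<in> \<omega>"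
proof -
  obtain k n where kn: "(parent ^^ (k + i)) x = \<xi> (n + i)" for i
    using ancestor_meets_ray[of x] by blast
  have "range (\<lambda>n. (parent ^^ n) x) - range \<xi> \<subseteq> (\<lambda>n. (parent ^^ n) x) ` {..<k}"
  proof
    fix y assume "y \<in> range (\<lambda>n. (parent ^^ n) x) - range \<xi>"
    then obtain m where m: "y = (parent ^^ m) x" "y \<notin> range \<xi>" by auto
    then have "\<not> m \<ge> k" using kn[of "m - k"] by auto
    then show "y \<in> (\<lambda>n. (parent ^^ n) x) ` {..<k}" using m by auto
  qed
  moreover have "range \<xi> - range (\<lambda>n. (parent ^^ n) x) \<subseteq> \<xi> ` {..<n}"
  proof
    fix y assume "y \<in> range \<xi> - range (\<lambda>n. (parent ^^ n) x)"
    then obtain m where m: "y = \<xi> m" "y \<notin> range (\<lambda>n. (parent ^^ n) x)" by auto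
    have "\<xi> m = (parent ^^ (k + (m - n))) x" if "m \<ge> n" using kn[of "m - n"] that by simp
    with m have "\<not> m \<ge> n" by blast
    then show "y \<in> \<xi> ` {..<n}" using m by auto
  qed
  ultimately have "finite ((range \<xi> - range (\<lambda>n. (parent ^^ n) x)) \<union>
      (range (\<lambda>n. (parent ^^ n) x) - range \<xi>))"
    by (meson finite_Un finite_imageI finite_lessThan finite_subset)
  then show ?thesis using ray ancestors_geodesic by (simp add: ray_equiv_def)
qed

text \<open>A ray of the end through \<open>x\<close> visits \<open>\<xi>\<close> arbitrarily late, at vertices whose distance from \<open>x\<close>
  equals their level difference with \<open>x\<close>; so it goes from parent to parent all the way.\<close>

lemma ray_in_end_unique:
  assumes "\<eta> \<in> \<omega>"
  shows "\<eta> n = (parent ^^ n) (\<eta> 0)"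
proof -
  have geo: "d (\<eta> i) (\<eta> j) = j - i" if "i \<le> j" for i j
    using assms that by (auto simp: ray_equiv_def geodesic_rays_def)
  have fin: "finite (range \<eta> - range \<xi>)" using assms by (auto simp: ray_equiv_def)
  have "inj \<eta>"
  proof (rule linorder_injI)
    fix i j :: nat assume "i < j"
    then show "\<eta> i \<noteq> \<eta> j" using geo[of i j] dist_eq_0_iff[of "\<eta> i" "\<eta> j"] by auto
  qed
  obtain m0 where m0: "\<And>m. m \<ge> m0 \<Longrightarrow> int (d (\<eta> 0) (\<xi> m)) = level (\<eta> 0) + int m"
    using level_eventually by meson
  have "finite (\<eta> -` ((range \<eta> - range \<xi>) \<union> \<xi> ` {..<m0}))"
    using fin by (intro finite_vimageI \<open>inj \<eta>\<close>) simp
  then have "finite (\<eta> -` ((range \<eta> - range \<xi>) \<union> \<xi> ` {..<m0}) \<union> {..n})" by simp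
  then obtain i where "i \<notin> \<eta> -` ((range \<eta> - range \<xi>) \<union> \<xi> ` {..<m0}) \<union> {..n}"
    using ex_new_if_finite[OF infinite_UNIV_nat] by blast
  then have i: "i > n" "\<eta> i \<in> range \<xi>" "\<eta> i \<notin> \<xi> ` {..<m0}" by auto
  from i(2) obtain m where m: "\<eta> i = \<xi> m" by blast
  with i(3) have "m \<ge> m0" by (auto simp: not_less[symmetric])
  then have "level (\<eta> i) = level (\<eta> 0) - int i"
    using m0[of m] m geo[of 0 i] by (simp add: level_ray)
  then have "level (\<eta> 0) - level (\<eta> n) = int n"
    using level_lipschitz[of "\<eta> 0" "\<eta> n"] level_lipschitz[of "\<eta> n" "\<eta> i"] geo[of 0 n] geo[of n i] i
    by linarith
  then show ?thesis using ancestorI[of "\<eta> 0" "\<eta> n"] geo[of 0 n] by simp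
qed

lemma ray_to_eq: "ray_to \<omega> x = (\<lambda>n. (parent ^^ n) x)"
  unfolding ray_to_def
proof (rule the_equality)
  fix \<eta> assume "\<eta> \<in> \<omega> \<and> \<eta> 0 = x"
  then show "\<eta> = (\<lambda>n. (parent ^^ n) x)" using ray_in_end_unique by auto
qed (use ancestors_in_end in auto)

text \<open>The confluent of \<open>x\<close> and \<open>z\<close> is the first ancestor of \<open>x\<close> that is also an ancestor of \<open>z\<close>.\<close>

lemma busemann_eq: "busemann G z \<omega> x = level x - level z"
proof -
  let ?R = "\<lambda>x. range (\<lambda>n. (parent ^^ n) x)"
  obtain k n where kn: "(parent ^^ (k + i)) x = \<xi> (n + i)" for i
    using ancestor_meets_ray[of x] by blast
  obtain k' n' where kn': "(parent ^^ (k' + i)) z = \<xi> (n' + i)" for i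
    using ancestor_meets_ray[of z] by blast
  have "(parent ^^ (k + n')) x = (parent ^^ (k' + n)) z"
    using kn[of n'] kn'[of n] by (simp add: add.commute)
  then have ex: "\<exists>j. (parent ^^ j) x \<in> ?R z" by blast
  define j where "j = (LEAST j. (parent ^^ j) x \<in> ?R z)"
  have j: "(parent ^^ j) x \<in> ?R z" unfolding j_def using ex by (rule LeastI_ex)
  then obtain l where l: "(parent ^^ j) x = (parent ^^ l) z" by auto
  define c where "c = (parent ^^ j) x"
  have meet: "?R x \<inter> ?R z = ?R c"
  proof (intro equalityI subsetI)
    fix y assume y: "y \<in> ?R x \<inter> ?R z"
    then obtain i where i: "y = (parent ^^ i) x" by auto
    with y have "j \<le> i" unfolding j_def by (intro Least_le) auto
    then have "y = (parent ^^ (i - j)) c" unfolding i c_def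
      by (simp flip: funpow_add comp_apply[of "parent ^^ (i - j)"])
    then show "y \<in> ?R c" by auto
  next
    fix y assume "y \<in> ?R c"
    then obtain i where "y = (parent ^^ i) c" by auto
    then have "y = (parent ^^ (i + j)) x" "y = (parent ^^ (i + l)) z"
      unfolding c_def using l by (simp_all add: funpow_add)
    then show "y \<in> ?R x \<inter> ?R z" by blast
  qed
  have uniq: "b = c" if b: "?R x \<inter> ?R z = ?R b" for b
  proof -
    have self: "v \<in> ?R v" for v by (rule range_eqI[of _ _ 0]) simp
    have "?R b = ?R c" using b meet by simp
    with self[of b] self[of c] have "b \<in> ?R c" "c \<in> ?R b" by simp_all
    then obtain s t where st: "b = (parent ^^ s) c" "c = (parent ^^ t) b" by blast
    then have "level b = level c - int s" "level c = level b - int t"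
      using level_ancestor[of s c] level_ancestor[of t b] by simp_all
    then show ?thesis using st(1) by simp
  qed
  have "confluent \<omega> x z = c"
    unfolding confluent_def ray_to_eq by (rule the_equality) (fact meet, fact uniq)
  moreover have "int (d x c) = level x - level c" "int (d z c) = level z - level c"
    using dist_ancestor[of x j] level_ancestor[of j x] dist_ancestor[of z l] level_ancestor[of l z]
    by (simp_all add: c_def flip: l)
  ultimately show ?thesis unfolding busemann_def by simp
qed

end

lemma homogeneous_tree_parent:
  assumes "homogeneous_tree p G" and "\<omega> \<in> ends G"
  obtains \<pi> where "\<And>x. busemann G z \<omega> (\<pi> x) = busemann G z \<omega> x - 1"
    and "\<And>x y. G x y \<longleftrightarrow> y = \<pi> x \<or> x = \<pi> y"
    and "\<And>x. card {y. \<pi> y = x} = p" and "busemann G z \<omega> z = 0"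
proof -
  obtain \<xi> where \<xi>: "\<xi> \<in> geodesic_rays G" "\<omega> = ray_equiv G `` {\<xi>}"
    using assms(2) unfolding ends_def by (auto elim: quotientE)
  interpret rayed_tree G \<xi>
    using assms(1) \<xi>(1) by unfold_locales (simp_all add: homogeneous_tree_def)
  have lev: "busemann G z \<omega> x = level x - level z" for x
    unfolding \<xi>(2) by (rule busemann_eq)
  have "card {y. parent y = x} = p" for x
  proof -
    have "{y. G x y} = insert (parent x) {y. parent y = x}" by (auto simp: adj_iff_parent)
    moreover have "parent x \<notin> {y. parent y = x}"
    proof
      assume "parent x \<in> {y. parent y = x}"
      then have "level x = level x - 2" using parent(2)[of x] parent(2)[of "parent x"] by simp
      then show False by simp
    qed
    moreover have card: "card {y. G x y} = p + 1" using assms(1) by (simp add: homogeneous_tree_def)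
    moreover have "finite {y. G x y}" using card by (intro card_ge_0_finite) simp
    ultimately show ?thesis by simp
  qed
  then show thesis
    using parent adj_iff_parent by (intro that[of parent]) (simp_all add: lev)
qed

section \<open>Signed branch functions on a tree with levels\<close>

text \<open>The structure that a reference end induces on a homogeneous tree: a parent map that lowers
  the level by one and is \<open>q\<close> to one.\<close>

locale levelled_forest =
  fixes \<pi> :: "'a \<Rightarrow> 'a" and h :: "'a \<Rightarrow> int" and q :: nat
  assumes h_parent: "h (\<pi> x) = h x - 1"
    and card_children: "card {y. \<pi> y = x} = q"
    and q_pos: "q > 0"
begin

definition desc :: "'a \<Rightarrow> nat \<Rightarrow> 'a set" where
  "desc c k = {y. (\<pi> ^^ k) y = c}"

text \<open>On the vertices below the parent of \<open>c\<close>, this is the indicator of the branch through \<open>c\<close>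
  minus the average over the \<open>q\<close> branches; elsewhere it is zero.\<close>

definition branch :: "'a \<Rightarrow> 'a \<Rightarrow> real" where
  "branch c y = (if h c \<le> h y
     then of_bool ((\<pi> ^^ nat (h y - h c)) y = c)
       - of_bool ((\<pi> ^^ Suc (nat (h y - h c))) y = \<pi> c) / real q
     else 0)"

lemma finite_children: "finite {y. \<pi> y = x}"
  using card_children[of x] q_pos by (intro card_ge_0_finite) simp

lemma h_funpow: "h ((\<pi> ^^ k) x) = h x - int k"
  by (induction k) (simp_all add: h_parent)

lemma h_desc: "y \<in> desc c k \<Longrightarrow> h y = h c + int k"
  by (auto simp: desc_def h_funpow)

lemma desc_0: "desc c 0 = {c}"
  by (auto simp: desc_def)

lemma desc_Suc: "desc c (Suc k) = (\<Union>y\<in>desc c k. {z. \<pi> z = y})"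
  by (auto simp: desc_def funpow_swap1)

lemma finite_desc: "finite (desc c k)"
proof (induction k)
  case (Suc k)
  then show ?case unfolding desc_Suc by (intro finite_UN_I finite_children)
qed (simp add: desc_0)

lemma sum_desc_Suc:
  fixes F :: "'a \<Rightarrow> real"
  shows "(\<Sum>z\<in>desc c (Suc k). F z) = (\<Sum>y\<in>desc c k. \<Sum>z | \<pi> z = y. F z)"
proof -
  have "(\<Sum>y\<in>desc c k. \<Sum>z | \<pi> z = y. F z)
      = (\<Sum>y\<in>desc c k. \<Sum>z\<in>{z \<in> desc c (Suc k). \<pi> z = y}. F z)"
    by (intro sum.cong refl) (auto simp: desc_Suc)
  also have "\<dots> = (\<Sum>z\<in>desc c (Suc k). F z)"
    by (rule sum.group) (auto simp: finite_desc finite_children desc_Suc)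
  finally show ?thesis by simp
qed

lemma branch_support:
  assumes "branch c y \<noteq> 0"
  shows "h c \<le> h y" "y \<in> desc (\<pi> c) (Suc (nat (h y - h c)))"
proof -
  show h: "h c \<le> h y" using assms by (rule contrapos_np) (simp add: branch_def)
  have "(\<pi> ^^ Suc (nat (h y - h c))) y = \<pi> c"
  proof (rule ccontr)
    assume far: "(\<pi> ^^ Suc (nat (h y - h c))) y \<noteq> \<pi> c"
    have "(\<pi> ^^ nat (h y - h c)) y \<noteq> c" by (rule contrapos_nn[OF far]) simp
    with far assms h show False by (simp add: branch_def)
  qed
  then show "y \<in> desc (\<pi> c) (Suc (nat (h y - h c)))" by (simp add: desc_def)
qed

lemma branch_parent:
  assumes "h c < h y"
  shows "branch c (\<pi> y) = branch c y"
proof -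
  define k where "k = nat (h y - 1 - h c)"
  have k: "nat (h y - h c) = Suc k" "nat (h (\<pi> y) - h c) = k" "h c \<le> h (\<pi> y)" "h c \<le> h y"
    using assms by (simp_all add: k_def h_parent)
  have "(\<pi> ^^ Suc m) y = (\<pi> ^^ m) (\<pi> y)" for m by (simp add: funpow_swap1)
  with k show ?thesis unfolding branch_def by (simp only: if_True)
qed

lemma h_child: "\<pi> z = y \<Longrightarrow> h z = h y + 1"
  using h_parent[of z] by simp

lemma branch_child:
  assumes "\<pi> z = y" "h c \<le> h y"
  shows "branch c z = branch c y"
  using branch_parent[of c z] h_child[OF assms(1)] assms by simp

lemma branch_above: "h y < h c \<Longrightarrow> branch c y = 0"
  by (simp add: branch_def)

lemma sum_branch_children:
  "(\<Sum>z | \<pi> z = y. branch c z) = (if h c \<le> h y then real q * branch c y else 0)"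
proof -
  have hz: "h z = h y + 1" if "\<pi> z = y" for z using that by (rule h_child)
  consider "h c \<le> h y" | "h c = h y + 1" | "h c > h y + 1" by linarith
  then show ?thesis
  proof cases
    case 1
    then have "(\<Sum>z | \<pi> z = y. branch c z) = (\<Sum>z | \<pi> z = y. branch c y)"
      by (intro sum.cong refl branch_child) auto
    then show ?thesis using 1 by (simp add: card_children)
  next
    case 2
    have "(\<Sum>z | \<pi> z = y. branch c z)
        = (\<Sum>z | \<pi> z = y. of_bool (z = c) - of_bool (y = \<pi> c) / real q)"
      using 2 by (intro sum.cong) (auto simp: branch_def hz)
    also have "\<dots> = (\<Sum>z | \<pi> z = y. if z = c then 1 else 0) - of_bool (y = \<pi> c)"
      using q_pos by (simp add: sum_subtractf card_children of_bool_def)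
    also have "\<dots> = 0" by (auto simp: finite_children)
    finally show ?thesis using 2 by simp
  next
    case 3
    then have "(\<Sum>z | \<pi> z = y. branch c z) = 0"
      by (intro sum.neutral) (auto simp: branch_above hz)
    then show ?thesis using 3 by simp
  qed
qed

lemma sum_branch_squares:
  "(\<Sum>y\<in>desc (\<pi> c) (Suc k). (branch c y)\<^sup>2) = (1 - 1 / real q) * real q ^ k"
proof (induction k)
  case 0
  have "desc (\<pi> c) (Suc 0) = {y. \<pi> y = \<pi> c}" by (simp add: desc_def)
  moreover have "(branch c y)\<^sup>2 = (if y = c then 1 - 2 / real q else 0) + (1 / real q)\<^sup>2"
    if "\<pi> y = \<pi> c" for y
  proof -
    have "h y = h c" using h_child[OF that] h_child[of c, OF refl] by linarith
    then have eq: "branch c y = of_bool (y = c) - 1 / real q" using that by (simp add: branch_def)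
    show ?thesis unfolding eq by (simp add: power2_diff)
  qed
  ultimately have "(\<Sum>y\<in>desc (\<pi> c) (Suc 0). (branch c y)\<^sup>2)
      = (\<Sum>y | \<pi> y = \<pi> c. (if y = c then 1 - 2 / real q else 0) + (1 / real q)\<^sup>2)"
    by simp
  also have "\<dots> = 1 - 2 / real q + real q * (1 / real q)\<^sup>2"
    by (simp add: sum.distrib finite_children card_children)
  also have "\<dots> = 1 - 1 / real q" using q_pos by (simp add: field_simps power2_eq_square)
  finally show ?case by simp
next
  case (Suc k)
  have "(\<Sum>z | \<pi> z = y. (branch c z)\<^sup>2) = real q * (branch c y)\<^sup>2"
    if "y \<in> desc (\<pi> c) (Suc k)" for y
  proof -
    have "h c \<le> h y" using h_desc[OF that] by (simp add: h_parent)
    then have "(\<Sum>z | \<pi> z = y. (branch c z)\<^sup>2) = (\<Sum>z | \<pi> z = y. (branch c y)\<^sup>2)"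
      using branch_child by (intro sum.cong refl) simp
    then show ?thesis by (simp add: card_children)
  qed
  then have "(\<Sum>y\<in>desc (\<pi> c) (Suc (Suc k)). (branch c y)\<^sup>2)
      = (\<Sum>y\<in>desc (\<pi> c) (Suc k). real q * (branch c y)\<^sup>2)"
    unfolding sum_desc_Suc[of _ "\<pi> c" "Suc k"] by (intro sum.cong) auto
  then show ?case using Suc.IH by (simp flip: sum_distrib_left)
qed

text \<open>Where \<open>branch c\<close> lives, a branch function starting at a lower level does not distinguish
  siblings, while \<open>branch c\<close> sums to zero over the children of the parent of \<open>c\<close>.\<close>

lemma sum_branch_orthogonal:
  assumes "h c' < h c"
  shows "(\<Sum>y\<in>desc (\<pi> c) (Suc k). branch c y * branch c' y) = 0"
proof (induction k)
  case 0
  have "desc (\<pi> c) (Suc 0) = {y. \<pi> y = \<pi> c}" by (simp add: desc_def)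
  moreover have "branch c' y = branch c' (\<pi> c)" if "\<pi> y = \<pi> c" for y
  proof (rule branch_child[OF that])
    show "h c' \<le> h (\<pi> c)" using assms h_child[of c, OF refl] by linarith
  qed
  ultimately have "(\<Sum>y\<in>desc (\<pi> c) (Suc 0). branch c y * branch c' y)
      = (\<Sum>y | \<pi> y = \<pi> c. branch c y) * branch c' (\<pi> c)"
    unfolding sum_distrib_right by simp
  then show ?case by (simp add: sum_branch_children h_parent)
next
  case (Suc k)
  have "(\<Sum>z | \<pi> z = y. branch c z * branch c' z) = real q * (branch c y * branch c' y)"
    if "y \<in> desc (\<pi> c) (Suc k)" for y
  proof -
    have "h c \<le> h y" using h_desc[OF that] by (simp add: h_parent)
    moreover from this have "h c' \<le> h y" using assms by simp
    ultimately have "(\<Sum>z | \<pi> z = y. branch c z * branch c' z)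
        = (\<Sum>z | \<pi> z = y. branch c y * branch c' y)"
      using branch_child by (intro sum.cong refl) simp
    then show ?thesis by (simp add: card_children)
  qed
  then have "(\<Sum>y\<in>desc (\<pi> c) (Suc (Suc k)). branch c y * branch c' y)
      = (\<Sum>y\<in>desc (\<pi> c) (Suc k). real q * (branch c y * branch c' y))"
    unfolding sum_desc_Suc[of _ "\<pi> c" "Suc k"] by (intro sum.cong) auto
  then show ?case using Suc.IH by (simp flip: sum_distrib_left)
qed

lemma branch_ancestor: "branch ((\<pi> ^^ k) x) x = 1 - 1 / real q"
  by (simp add: branch_def h_funpow)

end

section \<open>Eigenfunctions of the walk\<close>

locale forest_product =
  F1: levelled_forest \<pi>1 h1 q + F2: levelled_forest \<pi>2 h2 r
  for \<pi>1 :: "'a \<Rightarrow> 'a" and h1 q and \<pi>2 :: "'b \<Rightarrow> 'b" and h2 r +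
  fixes o1 :: 'a and o2 :: 'b
  assumes h_roots: "h1 o1 = 0" "h2 o2 = 0"
begin

definition V :: "('a \<times> 'b) set" where
  "V = {(y1, y2). h1 y1 + h2 y2 = 0}"

definition radial :: "nat \<Rightarrow> nat \<Rightarrow> nat \<Rightarrow> int \<Rightarrow> real" where
  "radial s t m l = sqrt (real r / real q) powi l
     * sin (real m * pi / real (s + t + 2) * real_of_int (l + int s + 1))"

text \<open>The factors in the two trees have level at least \<open>-s\<close> and at least \<open>-t\<close>, so at most
  \<open>s + t + 1\<close> levels of the product carry \<open>eigenfun s t m\<close>. On these the walk acts as a
  tridiagonal Toeplitz matrix with eigenvector \<open>radial s t m\<close>: a sine wave with zeros at the two
  levels next to the range, rescaled by powers of \<open>sqrt (r / q)\<close> because the weights of upward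
  and downward steps differ.\<close>

definition eigenfun :: "nat \<Rightarrow> nat \<Rightarrow> nat \<Rightarrow> 'a \<times> 'b \<Rightarrow> real" where
  "eigenfun s t m y = (if y \<in> V
     then F1.branch ((\<pi>1 ^^ s) o1) (fst y) * F2.branch ((\<pi>2 ^^ t) o2) (snd y)
       * radial s t m (h1 (fst y))
     else 0)"

lemma radial_recurrence:
  "real q * radial s t m (l + 1) + real r * radial s t m (l - 1)
    = 2 * sqrt (real (q * r)) * cos (real m * pi / real (s + t + 2)) * radial s t m l"
proof -
  define \<theta> where "\<theta> = real m * pi / real (s + t + 2)"
  define \<rho> where "\<rho> = sqrt (real r / real q)"
  define x where "x = \<theta> * real_of_int (l + int s + 1)"
  have \<rho>: "\<rho> > 0" using F1.q_pos F2.q_pos by (simp add: \<rho>_def)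
  have q\<rho>: "real q * \<rho> = sqrt (real (q * r))"
  proof -
    have "sqrt (real (q * r)) = sqrt ((real q)\<^sup>2 * (real r / real q))"
      using F1.q_pos by (simp add: power2_eq_square)
    then show ?thesis unfolding real_sqrt_mult \<rho>_def by simp
  qed
  have r\<rho>: "real r / \<rho> = sqrt (real (q * r))"
  proof -
    have "real r = (real q * \<rho>) * \<rho>"
      using F1.q_pos F2.q_pos unfolding \<rho>_def by (simp add: mult.assoc)
    then show ?thesis using \<rho> q\<rho> by (simp add: field_simps)
  qed
  have "radial s t m (l + 1) = \<rho> powi l * \<rho> * sin (x + \<theta>)"
    using \<rho> unfolding radial_def \<theta>_def[symmetric] \<rho>_def[symmetric] x_def
    by (simp add: power_int_add algebra_simps)
  moreover have "radial s t m (l - 1) = \<rho> powi l / \<rho> * sin (x - \<theta>)"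
    using \<rho> unfolding radial_def \<theta>_def[symmetric] \<rho>_def[symmetric] x_def
    by (simp add: power_int_diff algebra_simps)
  moreover have "radial s t m l = \<rho> powi l * sin x"
    unfolding radial_def \<theta>_def[symmetric] \<rho>_def[symmetric] x_def by simp
  ultimately have "real q * radial s t m (l + 1) + real r * radial s t m (l - 1)
      = (real q * \<rho>) * \<rho> powi l * sin (x + \<theta>) + (real r / \<rho>) * \<rho> powi l * sin (x - \<theta>)"
    by simp
  also have "\<dots> = sqrt (real (q * r)) * \<rho> powi l * (sin (x + \<theta>) + sin (x - \<theta>))"
    unfolding q\<rho> r\<rho> by (simp only: distrib_left)
  also have "\<dots> = 2 * sqrt (real (q * r)) * cos \<theta> * (\<rho> powi l * sin x)"
    by (simp add: sin_add sin_diff)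
  finally show ?thesis
    using \<open>radial s t m l = \<rho> powi l * sin x\<close> unfolding \<theta>_def by simp
qed

lemma radial_boundary:
  "radial s t m (- int s - 1) = 0" "radial s t m (int t + 1) = 0"
proof -
  show "radial s t m (- int s - 1) = 0" by (simp add: radial_def)
  have "real m * pi / real (s + t + 2) * real_of_int (int t + 1 + int s + 1) = real m * pi"
    by (simp add: field_simps)
  then show "radial s t m (int t + 1) = 0" by (simp only: radial_def sin_npi mult_zero_right)
qed

lemma eigenfun_neighbour_sum:
  assumes y: "y \<in> V"
  shows "(\<Sum>z | \<pi>1 z = fst y. eigenfun s t m (z, \<pi>2 (snd y)))
      + (\<Sum>z | \<pi>2 z = snd y. eigenfun s t m (\<pi>1 (fst y), z))
    = 2 * sqrt (real (q * r)) * cos (real m * pi / real (s + t + 2)) * eigenfun s t m y"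
proof -
  define c1 c2 where "c1 = (\<pi>1 ^^ s) o1" and "c2 = (\<pi>2 ^^ t) o2"
  have c: "h1 c1 = - int s" "h2 c2 = - int t"
    unfolding c1_def c2_def by (simp_all add: F1.h_funpow F2.h_funpow h_roots)
  obtain y1 y2 where yy: "y = (y1, y2)" by (cases y)
  define l where "l = h1 y1"
  have h: "h1 y1 = l" "h2 y2 = - l" using y unfolding V_def yy l_def by auto
  have "eigenfun s t m (z, \<pi>2 y2) = F1.branch c1 z * (F2.branch c2 (\<pi>2 y2) * radial s t m (l + 1))"
    if "\<pi>1 z = y1" for z
    using F1.h_child[OF that] F2.h_parent[of y2] h
    unfolding eigenfun_def V_def c1_def[symmetric] c2_def[symmetric] by simp
  then have 1: "(\<Sum>z | \<pi>1 z = y1. eigenfun s t m (z, \<pi>2 y2))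
      = (\<Sum>z | \<pi>1 z = y1. F1.branch c1 z) * (F2.branch c2 (\<pi>2 y2) * radial s t m (l + 1))"
    unfolding sum_distrib_right by (intro sum.cong) auto
  have "eigenfun s t m (\<pi>1 y1, z) = F2.branch c2 z * (F1.branch c1 (\<pi>1 y1) * radial s t m (l - 1))"
    if "\<pi>2 z = y2" for z
    using F2.h_child[OF that] F1.h_parent[of y1] h
    unfolding eigenfun_def V_def c1_def[symmetric] c2_def[symmetric] by simp
  then have 2: "(\<Sum>z | \<pi>2 z = y2. eigenfun s t m (\<pi>1 y1, z))
      = (\<Sum>z | \<pi>2 z = y2. F2.branch c2 z) * (F1.branch c1 (\<pi>1 y1) * radial s t m (l - 1))"
    unfolding sum_distrib_right by (intro sum.cong) auto
  have 3: "eigenfun s t m (y1, y2) = F1.branch c1 y1 * F2.branch c2 y2 * radial s t m l"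
    using h unfolding eigenfun_def V_def c1_def[symmetric] c2_def[symmetric] by simp
  consider "l < - int s" | "l > int t" | "- int s \<le> l" "l \<le> int t" by linarith
  then show ?thesis
  proof cases
    case 1
    have "F1.branch c1 y1 = 0" "F1.branch c1 (\<pi>1 y1) = 0" "\<not> h1 c1 \<le> h1 y1"
      using 1 by (auto simp: F1.branch_above h F1.h_parent c)
    then show ?thesis unfolding yy fst_conv snd_conv \<open>_ = _ * (F2.branch c2 (\<pi>2 y2) * _)\<close> 2 3
      by (simp add: F1.sum_branch_children)
  next
    case 2
    have "F2.branch c2 y2 = 0" "F2.branch c2 (\<pi>2 y2) = 0" "\<not> h2 c2 \<le> h2 y2"
      using 2 by (auto simp: F2.branch_above h F2.h_parent c)
    then show ?thesis unfolding yy fst_conv snd_conv 1 \<open>_ = _ * (F1.branch c1 (\<pi>1 y1) * _)\<close> 3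
      by (simp add: F2.sum_branch_children)
  next
    case 3
    \<comment> \<open>Only at an extreme level does \<open>branch\<close> change from a vertex to its parent, and there the
      factor \<open>radial\<close> is zero.\<close>
    have up: "F2.branch c2 (\<pi>2 y2) * radial s t m (l + 1) = F2.branch c2 y2 * radial s t m (l + 1)"
    proof (cases "l = int t")
      case True
      then show ?thesis using radial_boundary by simp
    next
      case False
      then show ?thesis using 3 F2.branch_parent[of c2 y2] by (simp add: h c)
    qed
    have down: "F1.branch c1 (\<pi>1 y1) * radial s t m (l - 1) = F1.branch c1 y1 * radial s t m (l - 1)"
    proof (cases "l = - int s")
      case True
      then show ?thesis using radial_boundary by simp
    next
      case False
      then show ?thesis using 3 F1.branch_parent[of c1 y1] by (simp add: h c)
    qed
    have s1: "(\<Sum>z | \<pi>1 z = y1. F1.branch c1 z) = real q * F1.branch c1 y1"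
      using 3 by (simp add: F1.sum_branch_children h c)
    have s2: "(\<Sum>z | \<pi>2 z = y2. F2.branch c2 z) = real r * F2.branch c2 y2"
      using 3 by (simp add: F2.sum_branch_children h c)
    have "(\<Sum>z | \<pi>1 z = y1. eigenfun s t m (z, \<pi>2 y2)) + (\<Sum>z | \<pi>2 z = y2. eigenfun s t m (\<pi>1 y1, z))
      = F1.branch c1 y1 * F2.branch c2 y2
        * (real q * radial s t m (l + 1) + real r * radial s t m (l - 1))"
      unfolding \<open>_ = _ * (F2.branch c2 (\<pi>2 y2) * _)\<close> \<open>_ = _ * (F1.branch c1 (\<pi>1 y1) * _)\<close>
        up down s1 s2 by (simp add: algebra_simps)
    then show ?thesis
      unfolding yy fst_conv snd_conv radial_recurrence
      unfolding \<open>eigenfun s t m (y1, y2) = _\<close> by (simp only: mult_ac)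
  qed
qed

definition level_set :: "nat \<Rightarrow> nat \<Rightarrow> nat \<Rightarrow> ('a \<times> 'b) set" where
  "level_set s t k = F1.desc (\<pi>1 ((\<pi>1 ^^ s) o1)) (Suc k) \<times> F2.desc (\<pi>2 ((\<pi>2 ^^ t) o2)) (Suc (s + t - k))"

lemma level_set_level:
  assumes "y \<in> level_set s t k" "k \<le> s + t"
  shows "h1 (fst y) = int k - int s" "h2 (snd y) = int s - int k" "y \<in> V"
proof -
  obtain y1 y2 where y: "y = (y1, y2)" by (cases y)
  have y': "y1 \<in> F1.desc (\<pi>1 ((\<pi>1 ^^ s) o1)) (Suc k)"
    "y2 \<in> F2.desc (\<pi>2 ((\<pi>2 ^^ t) o2)) (Suc (s + t - k))"
    using assms(1) unfolding level_set_def y by auto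
  have "h1 y1 = int k - int s"
    using F1.h_desc[OF y'(1)] by (simp add: F1.h_parent F1.h_funpow h_roots)
  moreover have "h2 y2 = int s - int k"
    using F2.h_desc[OF y'(2)] assms(2) by (simp add: F2.h_parent F2.h_funpow h_roots)
  ultimately show "h1 (fst y) = int k - int s" "h2 (snd y) = int s - int k" "y \<in> V"
    by (simp_all add: y V_def)
qed

lemma eigenfun_support:
  assumes "eigenfun s t m y \<noteq> 0"
  shows "y \<in> (\<Union>k\<le>s + t. level_set s t k)"
proof -
  obtain y1 y2 where y: "y = (y1, y2)" by (cases y)
  have b: "h1 y1 + h2 y2 = 0" "F1.branch ((\<pi>1 ^^ s) o1) y1 \<noteq> 0" "F2.branch ((\<pi>2 ^^ t) o2) y2 \<noteq> 0"
    using assms by (auto simp: eigenfun_def y V_def split: if_splits)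
  note s1 = F1.branch_support[OF b(2), unfolded F1.h_funpow h_roots]
    and s2 = F2.branch_support[OF b(3), unfolded F2.h_funpow h_roots]
  define k where "k = nat (h1 y1 + int s)"
  have "k \<le> s + t" using s1(1) s2(1) b(1) unfolding k_def by linarith
  moreover have "nat (h1 y1 - (0 - int s)) = k" "nat (h2 y2 - (0 - int t)) = s + t - k"
    using s1(1) s2(1) b(1) unfolding k_def by linarith+
  ultimately show ?thesis using s1(2) s2(2) unfolding y level_set_def by auto
qed

lemma finite_level_set: "finite (level_set s t k)"
  unfolding level_set_def by (intro finite_cartesian_product F1.finite_desc F2.finite_desc)

lemma eigenfun_inner:
  "ell2_inner V (\<lambda>y. complex_of_real (eigenfun s t m y)) (\<lambda>y. complex_of_real (eigenfun s' t' m' y))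
  = complex_of_real (\<Sum>k\<le>s + t. radial s t m (int k - int s) * radial s' t' m' (int k - int s)
    * (\<Sum>y\<in>F1.desc (\<pi>1 ((\<pi>1 ^^ s) o1)) (Suc k).
         F1.branch ((\<pi>1 ^^ s) o1) y * F1.branch ((\<pi>1 ^^ s') o1) y)
    * (\<Sum>y\<in>F2.desc (\<pi>2 ((\<pi>2 ^^ t) o2)) (Suc (s + t - k)).
         F2.branch ((\<pi>2 ^^ t) o2) y * F2.branch ((\<pi>2 ^^ t') o2) y))"
proof -
  let ?S = "\<Union>k\<le>s + t. level_set s t k"
  have "ell2_inner V (\<lambda>y. complex_of_real (eigenfun s t m y)) (\<lambda>y. complex_of_real (eigenfun s' t' m' y))
      = (\<Sum>y\<in>?S. cnj (complex_of_real (eigenfun s t m y)) * complex_of_real (eigenfun s' t' m' y))"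
  proof (rule ell2_inner_finite_support)
    show "?S \<subseteq> V" using level_set_level(3) by blast
    show "complex_of_real (eigenfun s t m y) = 0" if "y \<notin> ?S" for y
      using eigenfun_support[of s t m y] that by auto
  qed (simp add: finite_level_set)
  also have "\<dots> = complex_of_real (\<Sum>y\<in>?S. eigenfun s t m y * eigenfun s' t' m' y)" by simp
  also have "(\<Sum>y\<in>?S. eigenfun s t m y * eigenfun s' t' m' y)
      = (\<Sum>k\<le>s + t. \<Sum>y\<in>level_set s t k. eigenfun s t m y * eigenfun s' t' m' y)"
  proof (rule sum.UNION_disjoint)
    show "\<forall>k\<in>{..s + t}. \<forall>k'\<in>{..s + t}. k \<noteq> k' \<longrightarrow> level_set s t k \<inter> level_set s t k' = {}"
    proof (intro ballI impI)
      fix k k' assume k: "k \<in> {..s + t}" "k' \<in> {..s + t}" "k \<noteq> k'"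
      have False if "y \<in> level_set s t k" "y \<in> level_set s t k'" for y
        using level_set_level(1)[OF that(1)] level_set_level(1)[OF that(2)] k by simp
      then show "level_set s t k \<inter> level_set s t k' = {}" by blast
    qed
  qed (simp_all add: finite_level_set)
  also have "\<dots> = (\<Sum>k\<le>s + t. radial s t m (int k - int s) * radial s' t' m' (int k - int s)
    * (\<Sum>y\<in>F1.desc (\<pi>1 ((\<pi>1 ^^ s) o1)) (Suc k).
         F1.branch ((\<pi>1 ^^ s) o1) y * F1.branch ((\<pi>1 ^^ s') o1) y)
    * (\<Sum>y\<in>F2.desc (\<pi>2 ((\<pi>2 ^^ t) o2)) (Suc (s + t - k)).
         F2.branch ((\<pi>2 ^^ t) o2) y * F2.branch ((\<pi>2 ^^ t') o2) y))"
  proof (rule sum.cong[OF refl])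
    fix k assume "k \<in> {..s + t}"
    then have k: "k \<le> s + t" by simp
    let ?R = "radial s t m (int k - int s) * radial s' t' m' (int k - int s)"
    let ?B1 = "\<lambda>y. F1.branch ((\<pi>1 ^^ s) o1) y * F1.branch ((\<pi>1 ^^ s') o1) y"
    let ?B2 = "\<lambda>y. F2.branch ((\<pi>2 ^^ t) o2) y * F2.branch ((\<pi>2 ^^ t') o2) y"
    have "(\<Sum>y\<in>level_set s t k. eigenfun s t m y * eigenfun s' t' m' y)
        = (\<Sum>y\<in>level_set s t k. ?R * (?B1 (fst y) * ?B2 (snd y)))"
      by (intro sum.cong refl)
         (simp add: eigenfun_def level_set_level(1)[OF _ k] level_set_level(3)[OF _ k])
    also have "\<dots> = ?R * (\<Sum>y\<in>level_set s t k. ?B1 (fst y) * ?B2 (snd y))"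
      by (simp only: sum_distrib_left)
    also have "(\<Sum>y\<in>level_set s t k. ?B1 (fst y) * ?B2 (snd y))
        = (\<Sum>y\<in>F1.desc (\<pi>1 ((\<pi>1 ^^ s) o1)) (Suc k). ?B1 y)
        * (\<Sum>y\<in>F2.desc (\<pi>2 ((\<pi>2 ^^ t) o2)) (Suc (s + t - k)). ?B2 y)"
      unfolding level_set_def sum_product sum.cartesian_product by (simp add: case_prod_unfold)
    finally show "(\<Sum>y\<in>level_set s t k. eigenfun s t m y * eigenfun s' t' m' y)
      = ?R * (\<Sum>y\<in>F1.desc (\<pi>1 ((\<pi>1 ^^ s) o1)) (Suc k). ?B1 y)
        * (\<Sum>y\<in>F2.desc (\<pi>2 ((\<pi>2 ^^ t) o2)) (Suc (s + t - k)). ?B2 y)" by simp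
  qed
  finally show ?thesis .
qed

lemma eigenfun_ell2: "(\<lambda>y. complex_of_real (eigenfun s t m y)) \<in> ell2 V"
proof (rule ell2_finite_support)
  show "finite (\<Union>k\<le>s + t. level_set s t k)" by (simp add: finite_level_set)
  show "(\<Union>k\<le>s + t. level_set s t k) \<subseteq> V" using level_set_level(3) by blast
  show "complex_of_real (eigenfun s t m y) = 0" if "y \<notin> (\<Union>k\<le>s + t. level_set s t k)" for y
    using eigenfun_support[of s t m y] that by auto
qed

text \<open>It suffices that one of the indices in the first pair is smaller: the branch functions in
  that tree are then orthogonal on every level. The general case follows by symmetry.\<close>

lemma eigenfun_orthogonal:
  assumes "(s, t) \<noteq> (s', t')"
  shows "ell2_inner V (\<lambda>y. complex_of_real (eigenfun s t m y))
    (\<lambda>y. complex_of_real (eigenfun s' t' m' y)) = 0"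
proof -
  have less: "ell2_inner V (\<lambda>y. complex_of_real (eigenfun s t m y))
      (\<lambda>y. complex_of_real (eigenfun s' t' m' y)) = 0"
    if "s < s' \<or> t < t'" for s t m s' t' m'
  proof -
    have "h1 ((\<pi>1 ^^ s') o1) < h1 ((\<pi>1 ^^ s) o1) \<or> h2 ((\<pi>2 ^^ t') o2) < h2 ((\<pi>2 ^^ t) o2)"
      using that by (simp add: F1.h_funpow F2.h_funpow h_roots)
    then show ?thesis
      unfolding eigenfun_inner
      by (elim disjE) (simp_all only: F1.sum_branch_orthogonal F2.sum_branch_orthogonal
          mult_zero_left mult_zero_right sum.neutral_const of_real_0)
  qed
  show ?thesis
  proof (cases "s < s' \<or> t < t'")
    case False
    with assms have "s' < s \<or> t' < t" by auto
    then show ?thesis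
      using less[of s' s t' t m' m] by (subst ell2_inner_commute) simp
  qed (rule less)
qed

text \<open>The powers of \<open>r / q\<close> in \<open>radial\<close> compensate the growth of the two trees, so that every level
  contributes \<open>sin\<^sup>2\<close> times the same constant.\<close>

lemma eigenfun_sqnorm:
  "sqnorm V (\<lambda>y. complex_of_real (eigenfun s t m y))
    = (1 - 1 / real q) * (1 - 1 / real r) * real q ^ s * real r ^ t
      * (\<Sum>k\<le>s + t. (sin (real m * pi / real (s + t + 2) * real (k + 1)))\<^sup>2)"
proof -
  define x where "x = real r / real q"
  have x: "x > 0" using F1.q_pos F2.q_pos by (simp add: x_def)
  have "complex_of_real (sqnorm V (\<lambda>y. complex_of_real (eigenfun s t m y)))
    = complex_of_real (\<Sum>k\<le>s + t. (radial s t m (int k - int s))\<^sup>2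
      * ((1 - 1 / real q) * real q ^ k) * ((1 - 1 / real r) * real r ^ (s + t - k)))"
    unfolding ell2_inner_self[symmetric] eigenfun_inner
    by (simp only: power2_eq_square[symmetric] F1.sum_branch_squares F2.sum_branch_squares)
  then have "sqnorm V (\<lambda>y. complex_of_real (eigenfun s t m y))
    = (\<Sum>k\<le>s + t. (radial s t m (int k - int s))\<^sup>2
      * ((1 - 1 / real q) * real q ^ k) * ((1 - 1 / real r) * real r ^ (s + t - k)))"
    by (simp only: of_real_eq_iff)
  also have "\<dots> = (\<Sum>k\<le>s + t. (1 - 1 / real q) * (1 - 1 / real r) * real q ^ s * real r ^ t
      * (sin (real m * pi / real (s + t + 2) * real (k + 1)))\<^sup>2)"
  proof (rule sum.cong[OF refl])
    fix k assume "k \<in> {..s + t}"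
    then have k: "k \<le> s + t" by simp
    have "(sqrt x powi (int k - int s))\<^sup>2 * real q ^ k * real r ^ (s + t - k)
        = (x ^ k / x ^ s) * real q ^ k * real r ^ (s + t - k)"
      using x by (simp add: power_int_diff power_divide flip: power_mult)
        (simp add: power_mult mult.commute[of _ 2])
    also have "\<dots> = real r ^ (k + (s + t - k)) / x ^ s"
      using F1.q_pos by (simp add: x_def power_divide power_add)
    also have "\<dots> = real q ^ s * real r ^ t"
      using k F1.q_pos F2.q_pos by (simp add: x_def power_divide power_add)
    finally have growth: "(sqrt x powi (int k - int s))\<^sup>2 * real q ^ k * real r ^ (s + t - k)
      = real q ^ s * real r ^ t" .
    have radial: "radial s t m (int k - int s) = sqrt x powi (int k - int s)
        * sin (real m * pi / real (s + t + 2) * real (k + 1))"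
      unfolding radial_def x_def by (simp add: add.commute)
    have regroup: "(a * b)\<^sup>2 * (u * y) * (v * z) = u * v * (a\<^sup>2 * y * z) * b\<^sup>2" for a b u v y z :: real
      by (simp add: power_mult_distrib)
    show "(radial s t m (int k - int s))\<^sup>2
        * ((1 - 1 / real q) * real q ^ k) * ((1 - 1 / real r) * real r ^ (s + t - k))
      = (1 - 1 / real q) * (1 - 1 / real r) * real q ^ s * real r ^ t
        * (sin (real m * pi / real (s + t + 2) * real (k + 1)))\<^sup>2"
      unfolding radial regroup growth by (simp only: mult.assoc)
  qed
  finally show ?thesis by (simp only: sum_distrib_left)
qed

lemma roots_in_V: "(o1, o2) \<in> V"
  by (simp add: V_def h_roots)

lemma eigenfun_root:
  "eigenfun s t m (o1, o2) = (1 - 1 / real q) * (1 - 1 / real r)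
    * sin (real m * pi / real (s + t + 2) * real (s + 1))"
  using roots_in_V
  by (simp add: eigenfun_def F1.branch_ancestor F2.branch_ancestor radial_def h_roots add.commute)

end

section \<open>Trigonometric sums\<close>

text \<open>The left-hand sum is the real part of a geometric sum with ratio \<open>z = x cis (2 \<theta>)\<close>, and
  the factor next to it is \<open>|z - 1|\<^sup>2\<close>; the assumptions say that \<open>z ^ N = x ^ N\<close>.\<close>

lemma sum_power_cos:
  fixes x \<theta> :: real
  assumes "cos (2 * \<theta> * real N) = 1" "sin (2 * \<theta> * real N) = 0"
  shows "(\<Sum>i<N. x ^ i * cos (2 * \<theta> * real i)) * ((x - 1)\<^sup>2 + 4 * x * (sin \<theta>)\<^sup>2)
    = (x ^ N - 1) * (x * cos (2 * \<theta>) - 1)"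
proof -
  define z where "z = complex_of_real x * cis (2 * \<theta>)"
  define S where "S = (\<Sum>i<N. z ^ i)"
  have pow: "z ^ i = complex_of_real (x ^ i) * cis (2 * \<theta> * real i)" for i
    unfolding z_def power_mult_distrib Complex.DeMoivre by (simp add: mult_ac)
  have "z ^ N = complex_of_real (x ^ N)"
    unfolding pow using assms by (simp add: complex_eq_iff)
  then have "(z - 1) * S = complex_of_real (x ^ N - 1)"
    unfolding S_def power_diff_1_eq[symmetric] by simp
  then have "cnj (z - 1) * (z - 1) * S = complex_of_real (x ^ N - 1) * cnj (z - 1)"
    by (simp add: mult.assoc mult.commute)
  also have "cnj (z - 1) * (z - 1) = complex_of_real ((cmod (z - 1))\<^sup>2)"
    by (metis complex_norm_square mult.commute)
  also have "(cmod (z - 1))\<^sup>2 = (x * cos (2 * \<theta>) - 1)\<^sup>2 + (x * sin (2 * \<theta>))\<^sup>2"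
    unfolding z_def by (simp add: cmod_power2)
  also have "(x * c - 1)\<^sup>2 + (x * s)\<^sup>2 = x\<^sup>2 * (s\<^sup>2 + c\<^sup>2) - 2 * x * c + 1" for c s
    by (simp add: power2_eq_square algebra_simps)
  also have "x\<^sup>2 * ((sin (2 * \<theta>))\<^sup>2 + (cos (2 * \<theta>))\<^sup>2) - 2 * x * cos (2 * \<theta>) + 1
      = (x - 1)\<^sup>2 + 4 * x * (sin \<theta>)\<^sup>2"
    by (subst sin_cos_squared_add, subst cos_double_sin) (simp add: power2_diff algebra_simps)
  finally have "Re (complex_of_real ((x - 1)\<^sup>2 + 4 * x * (sin \<theta>)\<^sup>2) * S)
      = Re (complex_of_real (x ^ N - 1) * cnj (z - 1))"
    by (rule arg_cong)
  then have "((x - 1)\<^sup>2 + 4 * x * (sin \<theta>)\<^sup>2) * Re S = (x ^ N - 1) * (x * cos (2 * \<theta>) - 1)"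
    by (simp only: Re_complex_of_real times_complex.sel Im_complex_of_real) (simp add: z_def)
  moreover have "Re S = (\<Sum>i<N. x ^ i * cos (2 * \<theta> * real i))"
    unfolding S_def pow by simp
  ultimately show ?thesis by (simp only: mult.commute)
qed

lemma sum_power_sin_squares:
  fixes x \<theta> :: real
  assumes N: "cos (2 * \<theta> * real N) = 1" "sin (2 * \<theta> * real N) = 0"
    and x: "x > 0" "x \<noteq> 1"
  shows "(\<Sum>i<N. x ^ i * (sin (\<theta> * real i))\<^sup>2)
    = (x ^ N - 1) * x * (x + 1) * (sin \<theta>)\<^sup>2 / ((x - 1) * ((x - 1)\<^sup>2 + 4 * x * (sin \<theta>)\<^sup>2))"
proof -
  let ?D = "(x - 1)\<^sup>2 + 4 * x * (sin \<theta>)\<^sup>2" and ?C = "\<Sum>i<N. x ^ i * cos (2 * \<theta> * real i)"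
  have D: "?D \<noteq> 0" using x by (intro less_imp_neq[symmetric] add_pos_nonneg) auto
  have "x ^ i * (sin (\<theta> * real i))\<^sup>2 = (x ^ i - x ^ i * cos (2 * \<theta> * real i)) / 2" for i
  proof -
    have "(sin (\<theta> * real i))\<^sup>2 = (1 - cos (2 * \<theta> * real i)) / 2"
      using cos_double_sin[of "\<theta> * real i"] by (simp add: mult.assoc)
    then show ?thesis by (simp only: right_diff_distrib' times_divide_eq_right mult_1_right)
  qed
  then have "(\<Sum>i<N. x ^ i * (sin (\<theta> * real i))\<^sup>2) = ((\<Sum>i<N. x ^ i) - ?C) / 2"
    by (simp only: sum_divide_distrib[symmetric] sum_subtractf)
  also have "?C = (x ^ N - 1) * (x * cos (2 * \<theta>) - 1) / ?D"
    by (rule eq_divide_imp[OF D sum_power_cos[OF N]])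
  also have "(\<Sum>i<N. x ^ i) = (x ^ N - 1) / (x - 1)"
    using x by (intro geometric_sum) simp
  also have "((x ^ N - 1) / (x - 1) - (x ^ N - 1) * (x * cos (2 * \<theta>) - 1) / ?D) / 2
      = (x ^ N - 1) * (?D - (x * cos (2 * \<theta>) - 1) * (x - 1)) / (2 * ((x - 1) * ?D))"
    using D x by (simp add: field_simps)
  also have "?D - (x * cos (2 * \<theta>) - 1) * (x - 1) = 2 * (x * (x + 1) * (sin \<theta>)\<^sup>2)"
    unfolding cos_double_sin by (simp only: power2_eq_square) (simp add: algebra_simps)
  also have "(x ^ N - 1) * (2 * (x * (x + 1) * (sin \<theta>)\<^sup>2)) / (2 * ((x - 1) * ?D))
      = (x ^ N - 1) * x * (x + 1) * (sin \<theta>)\<^sup>2 / ((x - 1) * ?D)"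
    by (simp only: mult.left_commute[of _ 2] mult_divide_mult_cancel_left_if) (simp add: mult.assoc)
  finally show ?thesis .
qed

lemma sum_sin_squares:
  fixes \<theta> :: real
  assumes N: "cos (2 * \<theta> * real N) = 1" "sin (2 * \<theta> * real N) = 0" and "sin \<theta> \<noteq> 0"
  shows "(\<Sum>i<N. (sin (\<theta> * real i))\<^sup>2) = real N / 2"
proof -
  have "(\<Sum>i<N. cos (2 * \<theta> * real i)) = 0"
    using sum_power_cos[OF N, of 1] assms(3) by simp
  moreover have "(sin (\<theta> * real i))\<^sup>2 = (1 - cos (2 * \<theta> * real i)) / 2" for i
    using cos_double_sin[of "\<theta> * real i"] by (simp add: mult.assoc)
  ultimately show ?thesis
    by (simp only: sum_divide_distrib[symmetric] sum_subtractf) simp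
qed

lemma rational_angle:
  assumes "1 \<le> m" "m < n"
  shows "cos (2 * (real m / real n * pi) * real (k * n)) = 1"
    and "sin (2 * (real m / real n * pi) * real (k * n)) = 0"
    and "sin (real m / real n * pi) > 0"
proof -
  have eq: "2 * (real m / real n * pi) * real (k * n) = real (2 * (k * m)) * pi"
    using assms by simp
  show "cos (2 * (real m / real n * pi) * real (k * n)) = 1" unfolding eq cos_npi by simp
  show "sin (2 * (real m / real n * pi) * real (k * n)) = 0" unfolding eq by (rule sin_npi)
  have "real m / real n * pi < 1 * pi" using assms by (intro mult_strict_right_mono) simp_all
  then show "sin (real m / real n * pi) > 0" using assms by (intro sin_gt_zero) simp_all
qed

section \<open>The mass of an atom\<close>

text \<open>The mass that the eigenfunction with apexes \<open>i\<close> and \<open>n - i\<close> generations above the roots and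
  frequency \<open>m / n\<close> contributes to the Plancherel measure.\<close>

definition weight :: "nat \<Rightarrow> nat \<Rightarrow> nat \<times> nat \<times> nat \<Rightarrow> real" where
  "weight q r = (\<lambda>(n, i, m). (real q - 1) * (real r - 1) / (real q ^ i * real r ^ (n - i))
     * (2 / real n) * (sin (real m / real n * pi * real i))\<^sup>2)"

definition modes :: "nat \<Rightarrow> (nat \<times> nat \<times> nat) set" where
  "modes K = (SIGMA n:{2..K}. {1..<n} \<times> {1..<n})"

lemma finite_modes: "finite (modes K)"
  unfolding modes_def by simp

lemma sum_weight_frequencies:
  assumes "i \<in> {1..<n}"
  shows "(\<Sum>m = 1..<n. weight q r (n, i, m))
    = (real q - 1) * (real r - 1) / (real q ^ i * real r ^ (n - i))"
proof -
  have i: "1 \<le> i" "i < n" using assms by auto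
  have "(\<Sum>m = 1..<n. (sin (real m / real n * pi * real i))\<^sup>2)
      = (\<Sum>m<n. (sin (real i / real n * pi * real m))\<^sup>2)"
    by (intro sum.mono_neutral_cong_left) (auto simp: mult_ac Suc_le_eq)
  also have "\<dots> = real n / 2"
    using rational_angle(1,2)[OF i, of 1] rational_angle(3)[OF i] by (intro sum_sin_squares) auto
  finally have half: "(\<Sum>m = 1..<n. (sin (real m / real n * pi * real i))\<^sup>2) = real n / 2" .
  have "(\<Sum>m = 1..<n. weight q r (n, i, m))
      = (real q - 1) * (real r - 1) / (real q ^ i * real r ^ (n - i)) * (2 / real n)
        * (\<Sum>m = 1..<n. (sin (real m / real n * pi * real i))\<^sup>2)"
    by (simp only: weight_def prod.case sum_distrib_left)
  then show ?thesis using i unfolding half by simp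
qed

text \<open>The total mass factors as a Cauchy product of two geometric series with sum one.\<close>

lemma sum_weight_tendsto_1:
  assumes "q \<ge> 2" "r \<ge> 2"
  shows "(\<lambda>K. \<Sum>j\<in>modes K. weight q r j) \<longlonglongrightarrow> 1"
proof -
  define a where "a p i = (if i = 0 then 0 else (real p - 1) / real p ^ i)" for p i :: nat
  have a: "a p sums 1" "summable (\<lambda>i. norm (a p i))" if "p \<ge> 2" for p
  proof -
    have "(\<lambda>i. (real p - 1) / real p * (1 / real p) ^ i) sums ((real p - 1) / real p * (1 / (1 - 1 / real p)))"
      using that by (intro sums_mult geometric_sums) simp
    also have "(real p - 1) / real p * (1 / (1 - 1 / real p)) = 1"
      using that by (simp add: field_simps)
    also have "(\<lambda>i. (real p - 1) / real p * (1 / real p) ^ i) = (\<lambda>i. a p (Suc i))"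
      by (simp add: a_def power_divide fun_eq_iff)
    finally show "a p sums 1" using sums_Suc_iff[of "a p" 1] by (simp add: a_def)
    moreover have "norm (a p i) = a p i" for i using that by (simp add: a_def)
    ultimately show "summable (\<lambda>i. norm (a p i))" by (simp add: sums_iff)
  qed
  have "(\<lambda>n. \<Sum>i\<le>n. a q i * a r (n - i)) sums 1"
    using Cauchy_product_sums[OF a(2)[OF assms(1)] a(2)[OF assms(2)]]
      a(1)[OF assms(1)] a(1)[OF assms(2)] by (simp add: sums_iff)
  then have "(\<lambda>K. \<Sum>n\<le>K. \<Sum>i\<le>n. a q i * a r (n - i)) \<longlonglongrightarrow> 1"
    by (simp add: sums_def_le)
  moreover have "(\<Sum>j\<in>modes K. weight q r j) = (\<Sum>n\<le>K. \<Sum>i\<le>n. a q i * a r (n - i))" for K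
  proof -
    have "(\<Sum>j\<in>modes K. weight q r j) = (\<Sum>n = 2..K. \<Sum>i = 1..<n. \<Sum>m = 1..<n. weight q r (n, i, m))"
      unfolding modes_def by (simp add: sum.Sigma sum.cartesian_product split_def)
    also have "\<dots> = (\<Sum>n = 2..K. \<Sum>i = 1..<n. a q i * a r (n - i))"
      by (intro sum.cong refl) (subst sum_weight_frequencies, auto simp: a_def)
    also have "\<dots> = (\<Sum>n = 2..K. \<Sum>i\<le>n. a q i * a r (n - i))"
      by (intro sum.cong refl sum.mono_neutral_left) (auto simp: a_def)
    also have "\<dots> = (\<Sum>n\<le>K. \<Sum>i\<le>n. a q i * a r (n - i))"
    proof (intro sum.mono_neutral_left ballI)
      fix n assume "n \<in> {..K} - {2..K}"
      then have "n = 0 \<or> n = 1" by auto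
      then show "(\<Sum>i\<le>n. a q i * a r (n - i)) = 0" by (auto simp: a_def)
    qed auto
    finally show ?thesis .
  qed
  ultimately show ?thesis by simp
qed

definition atom_mass :: "nat \<Rightarrow> nat \<Rightarrow> nat \<Rightarrow> nat \<Rightarrow> real" where
  "atom_mass q r m n = (if r \<noteq> q then
     (ln (1 - 1 / real r ^ n) - ln (1 - 1 / real q ^ n)) / (real n * (real r - real q)) *
     (2 * real q * real r * (real q + real r) * (real q - 1) * (real r - 1) *
        (sin (real m / real n * pi))\<^sup>2 /
      ((real r - real q)\<^sup>2 + 4 * real q * real r * (sin (real m / real n * pi))\<^sup>2))
   else (real q - 1)\<^sup>2 / (real q ^ n - 1))"

lemma sums_log:
  assumes "p \<ge> 2" "n \<ge> 1"
  shows "(\<lambda>k. 1 / (real p ^ (Suc k * n) * real (Suc k))) sums (- ln (1 - 1 / real p ^ n))"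
proof -
  have "\<bar>- (1 / real p ^ n)\<bar> < 1" using assms one_less_power[of "real p" n] by simp
  from ln_series'[OF this]
  have "(\<lambda>k. - ((1 / real p ^ n) ^ k) / real k) sums ln (1 - 1 / real p ^ n)" by simp
  then have "(\<lambda>k. - ((1 / real p ^ n) ^ Suc k) / real (Suc k)) sums ln (1 - 1 / real p ^ n)"
    by (subst sums_Suc_iff) simp
  then have "(\<lambda>k. - (- ((1 / real p ^ n) ^ Suc k) / real (Suc k))) sums (- ln (1 - 1 / real p ^ n))"
    by (rule sums_minus)
  also have "(\<lambda>k. - (- ((1 / real p ^ n) ^ Suc k) / real (Suc k)))
      = (\<lambda>k. 1 / (real p ^ (Suc k * n) * real (Suc k)))"
    by (simp only: power_one_over power_mult[symmetric] mult.commute[of n]) simp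
  finally show ?thesis .
qed

text \<open>All modes with frequency \<open>m / n\<close> and size \<open>k n\<close> together. Up to the factor
  \<open>sin\<^sup>2\<close> the terms form a geometric progression with ratio \<open>r / q\<close>. Since \<open>sin\<close> vanishes at the
  end of the range, for \<open>r \<noteq> q\<close> the number \<open>k\<close> enters the sum only through the first factor.\<close>

lemma sum_weight_multiples:
  assumes q: "q \<ge> 2" and r: "r \<ge> 2" and mn: "1 \<le> m" "m < n" and k: "k \<ge> 1"
  shows "(\<Sum>i = 1..<k * n. weight q r (k * n, i, k * m))
    = (if r \<noteq> q then
        (1 / (real q ^ (k * n) * real k) - 1 / (real r ^ (k * n) * real k)) *
        (2 * real q * real r * (real q + real r) * (real q - 1) * (real r - 1) *
          (sin (real m / real n * pi))\<^sup>2 /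
          (real n * (real r - real q) *
            ((real r - real q)\<^sup>2 + 4 * real q * real r * (sin (real m / real n * pi))\<^sup>2)))
      else (real q - 1)\<^sup>2 / real q ^ (k * n))"
proof -
  define \<theta> where "\<theta> = real m / real n * pi"
  define N where "N = k * n"
  define x where "x = real r / real q"
  have N: "cos (2 * \<theta> * real N) = 1" "sin (2 * \<theta> * real N) = 0" "sin \<theta> > 0"
    unfolding \<theta>_def N_def using rational_angle[OF mn] by blast+
  have N0: "real N > 0" unfolding N_def using mn k by simp
  have x: "x > 0" unfolding x_def using q r by simp
  have angle: "real (k * m) / real (k * n) * pi = \<theta>" unfolding \<theta>_def using k by simp
  have "(\<Sum>i = 1..<N. weight q r (N, i, k * m))
      = (\<Sum>i = 1..<N. (real q - 1) * (real r - 1) / real r ^ N * (2 / real N) * (x ^ i * (sin (\<theta> * real i))\<^sup>2))"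
  proof (intro sum.cong refl)
    fix i assume "i \<in> {1..<N}"
    then have "real r ^ N = real r ^ (N - i) * real r ^ i" by (simp flip: power_add)
    then have "1 / (real q ^ i * real r ^ (N - i)) = x ^ i / real r ^ N"
      using q r by (simp add: x_def power_divide field_simps)
    moreover have "weight q r (N, i, k * m)
        = (1 / (real q ^ i * real r ^ (N - i))) * ((real q - 1) * (real r - 1) * (2 / real N) * (sin (\<theta> * real i))\<^sup>2)"
      unfolding weight_def N_def prod.case angle by simp
    ultimately show "weight q r (N, i, k * m)
        = (real q - 1) * (real r - 1) / real r ^ N * (2 / real N) * (x ^ i * (sin (\<theta> * real i))\<^sup>2)"
      by simp
  qed
  also have "\<dots> = (real q - 1) * (real r - 1) / real r ^ N * (2 / real N) * (\<Sum>i = 1..<N. x ^ i * (sin (\<theta> * real i))\<^sup>2)"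
    by (simp only: sum_distrib_left)
  also have "(\<Sum>i = 1..<N. x ^ i * (sin (\<theta> * real i))\<^sup>2) = (\<Sum>i<N. x ^ i * (sin (\<theta> * real i))\<^sup>2)"
    by (intro sum.mono_neutral_left) (auto simp: Suc_le_eq)
  finally have W: "(\<Sum>i = 1..<N. weight q r (N, i, k * m))
    = (real q - 1) * (real r - 1) / real r ^ N * (2 / real N) * (\<Sum>i<N. x ^ i * (sin (\<theta> * real i))\<^sup>2)" .
  show ?thesis
  proof (cases "r = q")
    case True
    then have "x = 1" using q unfolding x_def by simp
    then have S: "(\<Sum>i<N. x ^ i * (sin (\<theta> * real i))\<^sup>2) = real N / 2"
      using sum_sin_squares[OF N(1,2)] N(3) by simp
    show ?thesis using True N0 unfolding N_def[symmetric] W S by (simp add: power2_eq_square)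
  next
    case False
    have qr: "real q > 0" "real r > 0" "real r - real q \<noteq> 0" using q r False by auto
    have "x \<noteq> 1" using qr unfolding x_def by simp
    define u where "u = (sin \<theta>)\<^sup>2"
    define B where "B = (real r - real q)\<^sup>2 + 4 * real q * real r * u"
    have "u > 0" unfolding u_def using N(3) by simp
    then have B: "B > 0" unfolding B_def using qr by (intro add_nonneg_pos) auto
    have den: "(x - 1) * ((x - 1)\<^sup>2 + 4 * x * u) = (real r - real q) * B / real q ^ 3"
      unfolding x_def B_def using qr by (simp add: field_simps power2_eq_square power3_eq_cube)
    have num: "(x ^ N - 1) * x * (x + 1) * u
        = (real r ^ N / real q ^ N - 1) * (real r * (real q + real r) * u) / (real q)\<^sup>2"
      unfolding x_def using qr by (simp add: field_simps power2_eq_square power_divide)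
    have "a * b / (real q)\<^sup>2 / ((real r - real q) * B / real q ^ 3)
        = a * (real q * b) / ((real r - real q) * B)" for a b
      using qr by (simp add: power2_eq_square power3_eq_cube)
    then have S: "(\<Sum>i<N. x ^ i * (sin (\<theta> * real i))\<^sup>2)
      = (real r ^ N / real q ^ N - 1) * (real q * (real r * (real q + real r) * u)) / ((real r - real q) * B)"
      using sum_power_sin_squares[OF N(1,2) x \<open>x \<noteq> 1\<close>] unfolding u_def[symmetric] num den by simp
    have "(\<Sum>i = 1..<N. weight q r (N, i, k * m))
      = (1 / (real q ^ N * real k) - 1 / (real r ^ N * real k)) *
        (2 * real q * real r * (real q + real r) * (real q - 1) * (real r - 1) * u /
          (real n * (real r - real q) * B))"
    proof -
      have "(real r ^ N / real q ^ N - 1) / real r ^ N = 1 / real q ^ N - 1 / real r ^ N"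
        using qr by (simp add: field_simps)
      moreover have "a / c * (2 / (k' * n')) * (e * (f * (g * (f + g) * u')) / (d * b))
        = (e / c) / k' * (2 * f * g * (f + g) * a * u' / (n' * d * b))"
        for a b c d e f g k' n' u' :: real by (simp add: mult_ac)
      moreover have "real N = real k * real n" by (simp add: N_def)
      ultimately have "(\<Sum>i = 1..<N. weight q r (N, i, k * m))
        = (1 / real q ^ N - 1 / real r ^ N) / real k *
          (2 * real q * real r * (real q + real r) * ((real q - 1) * (real r - 1)) * u /
          (real n * (real r - real q) * B))"
        unfolding W S by (simp only:)
      then show ?thesis by (simp add: diff_divide_distrib mult.assoc)
    qed
    then show ?thesis using False unfolding B_def u_def \<theta>_def N_def by simp
  qed
qed

text \<open>Summing over \<open>k\<close> produces the logarithmic series at \<open>1 / q ^ n\<close> and \<open>1 / r ^ n\<close>, and for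
  \<open>r = q\<close>, where the factor \<open>1 / k\<close> cancels, a geometric series.\<close>

lemma sum_weight_tendsto_atom_mass:
  assumes q: "q \<ge> 2" and r: "r \<ge> 2" and mn: "1 \<le> m" "m < n"
  shows "(\<lambda>K. \<Sum>k = 1..K. \<Sum>i = 1..<k * n. weight q r (k * n, i, k * m)) \<longlonglongrightarrow> atom_mass q r m n"
proof -
  let ?W = "\<lambda>k. \<Sum>i = 1..<k * n. weight q r (k * n, i, k * m)"
  have "(\<lambda>k. ?W (Suc k)) sums atom_mass q r m n"
  proof (cases "r = q")
    case True
    have "real q ^ n > 1" using q mn by (intro one_less_power) auto
    then have "(\<lambda>k. (real q - 1)\<^sup>2 / real q ^ n * (1 / real q ^ n) ^ k) sums
        ((real q - 1)\<^sup>2 / real q ^ n * (1 / (1 - 1 / real q ^ n)))"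
      by (intro sums_mult geometric_sums) (simp add: divide_less_eq)
    also have "(real q - 1)\<^sup>2 / real q ^ n * (1 / (1 - 1 / real q ^ n)) = atom_mass q r m n"
      using \<open>real q ^ n > 1\<close> True q by (simp add: atom_mass_def field_simps)
    also have "(\<lambda>k. (real q - 1)\<^sup>2 / real q ^ n * (1 / real q ^ n) ^ k) = (\<lambda>k. ?W (Suc k))"
    proof
      fix k
      have "real q ^ (Suc k * n) = real q ^ n * (real q ^ n) ^ k"
        by (simp add: power_add power_mult mult.commute[of k])
      then show "(real q - 1)\<^sup>2 / real q ^ n * (1 / real q ^ n) ^ k = ?W (Suc k)"
        by (subst sum_weight_multiples[OF q r mn]) (simp_all add: True power_divide)
    qed
    finally show ?thesis .
  next
    case False
    define C where "C = 2 * real q * real r * (real q + real r) * (real q - 1) * (real r - 1) *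
      (sin (real m / real n * pi))\<^sup>2 / (real n * (real r - real q) *
        ((real r - real q)\<^sup>2 + 4 * real q * real r * (sin (real m / real n * pi))\<^sup>2))"
    have n: "n \<ge> 1" using mn by simp
    have "(\<lambda>k. (1 / (real q ^ (Suc k * n) * real (Suc k)) - 1 / (real r ^ (Suc k * n) * real (Suc k))) * C)
        sums ((- ln (1 - 1 / real q ^ n) - - ln (1 - 1 / real r ^ n)) * C)"
      by (intro sums_mult2 sums_diff sums_log q r n)
    also have "(- ln (1 - 1 / real q ^ n) - - ln (1 - 1 / real r ^ n)) * C = atom_mass q r m n"
      using False unfolding atom_mass_def C_def by (simp add: mult.assoc)
    also have "(\<lambda>k. (1 / (real q ^ (Suc k * n) * real (Suc k)) - 1 / (real r ^ (Suc k * n) * real (Suc k))) * C)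
        = (\<lambda>k. ?W (Suc k))"
      using False by (subst sum_weight_multiples[OF q r mn]) (simp_all add: C_def)
    finally show ?thesis .
  qed
  then have "(\<lambda>K. \<Sum>k<K. ?W (Suc k)) \<longlonglongrightarrow> atom_mass q r m n" by (simp add: sums_def)
  moreover have "(\<Sum>k<K. ?W (Suc k)) = (\<Sum>k = 1..K. ?W k)" for K by (rule sum_bounds_lt_plus1)
  ultimately show ?thesis by simp
qed

section \<open>The Plancherel measure\<close>

text \<open>Lower bounds for the atoms that exhaust the total mass one are sharp. Truncating to \<open>I K\<close>, any
  one atom, and the complement of all atoms, exceeds its lower bound by at most the mass that
  the truncation misses.\<close>

lemma exhausted_by_atoms:
  fixes M :: "real measure" and w :: "'i \<Rightarrow> real" and lam :: "'i \<Rightarrow> real"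
  assumes M: "finite_measure M" "sets M = sets borel" "measure M UNIV = 1"
    and I: "\<And>K::nat. finite (I K)" and w: "\<And>j. w j \<ge> 0"
    and lower: "\<And>K x. (\<Sum>j | j \<in> I K \<and> lam j = x. w j) \<le> measure M {x}"
    and total: "(\<lambda>K. \<Sum>j\<in>I K. w j) \<longlonglongrightarrow> 1"
  shows "(\<lambda>K. \<Sum>j | j \<in> I K \<and> lam j = x. w j) \<longlonglongrightarrow> measure M {x}"
    and "L \<in> sets borel \<Longrightarrow> (\<And>K. lam ` I K \<subseteq> L) \<Longrightarrow> emeasure M (- L) = 0"
proof -
  interpret finite_measure M by (rule M(1))
  have space: "space M = UNIV" using sets_eq_imp_space_eq[OF M(2)] by simp
  have finite_set: "measure M X = (\<Sum>y\<in>X. measure M {y})" if "finite X" for X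
    using that M(2) by (intro finite_measure_eq_sum_singleton) auto
  have group: "(\<Sum>y\<in>X. \<Sum>j | j \<in> I K \<and> lam j = y. w j) = (\<Sum>j\<in>I K. w j)"
    if "finite X" "lam ` I K \<subseteq> X" for X K
    using sum.group[OF I[of K] that(1) that(2), of w] by simp
  have mono: "measure M X \<le> 1" for X using bounded_measure[of X] M(3) by (simp add: space)
  have upper: "measure M {x} - (\<Sum>j | j \<in> I K \<and> lam j = x. w j) \<le> 1 - (\<Sum>j\<in>I K. w j)" for K
  proof -
    let ?X = "insert x (lam ` I K)"
    have X: "finite ?X" using I[of K] by simp
    have "measure M {x} - (\<Sum>j | j \<in> I K \<and> lam j = x. w j)
        \<le> (\<Sum>y\<in>?X. measure M {y} - (\<Sum>j | j \<in> I K \<and> lam j = y. w j))"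
      using X lower by (intro member_le_sum[where f = "\<lambda>y. measure M {y} - (\<Sum>j | j \<in> I K \<and> lam j = y. w j)"]) auto
    also have "\<dots> = measure M ?X - (\<Sum>j\<in>I K. w j)"
      unfolding sum_subtractf finite_set[OF X, symmetric] by (subst group[OF X]) auto
    also have "\<dots> \<le> 1 - (\<Sum>j\<in>I K. w j)" using mono by simp
    finally show ?thesis .
  qed
  have gap: "(\<lambda>K. 1 - (\<Sum>j\<in>I K. w j)) \<longlonglongrightarrow> 0"
    using tendsto_diff[OF tendsto_const total, of 1] by simp
  have "(\<lambda>K. measure M {x} - (\<Sum>j | j \<in> I K \<and> lam j = x. w j)) \<longlonglongrightarrow> 0"
    by (rule tendsto_sandwich[OF _ _ tendsto_const gap]) (use upper lower in auto)
  from tendsto_diff[OF tendsto_const this, of "measure M {x}"]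
  show "(\<lambda>K. \<Sum>j | j \<in> I K \<and> lam j = x. w j) \<longlonglongrightarrow> measure M {x}" by simp
  show "emeasure M (- L) = 0" if L: "L \<in> sets borel" "\<And>K. lam ` I K \<subseteq> L"
  proof -
    have "measure M (- L) \<le> 1 - (\<Sum>j\<in>I K. w j)" for K
    proof -
      have X: "finite (lam ` I K)" using I[of K] by simp
      have "(\<Sum>j\<in>I K. w j) = (\<Sum>y\<in>lam ` I K. \<Sum>j | j \<in> I K \<and> lam j = y. w j)"
        by (rule group[OF X, symmetric]) simp
      also have "\<dots> \<le> (\<Sum>y\<in>lam ` I K. measure M {y})" by (intro sum_mono lower)
      also have "\<dots> = measure M (lam ` I K)" by (rule finite_set[OF X, symmetric])
      finally have "(\<Sum>j\<in>I K. w j) \<le> measure M (lam ` I K)" .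
      moreover have "measure M (- L) + measure M (lam ` I K) = measure M (- L \<union> lam ` I K)"
        using L X M(2) borel_closed[OF finite_imp_closed[OF X]]
        by (intro finite_measure_Union[symmetric]) auto
      ultimately show ?thesis using mono[of "- L \<union> lam ` I K"] by linarith
    qed
    then have "measure M (- L) \<le> 0"
      by (intro tendsto_le[OF _ gap tendsto_const]) auto
    then show ?thesis using measure_nonneg[of M "- L"] by (simp add: emeasure_eq_measure)
  qed
qed

lemma DL_eigenvalue_eq_iff:
  assumes "q > 0" "r > 0" "1 \<le> m" "m < n" "1 \<le> m'" "m' < n'"
  shows "DL_eigenvalue q r m n = DL_eigenvalue q r m' n' \<longleftrightarrow> m * n' = m' * n"
proof -
  have range: "0 \<le> real a / real b * pi" "real a / real b * pi \<le> pi" if "1 \<le> a" "a < b" for a b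
  proof -
    have "real a / real b * pi \<le> 1 * pi" using that by (intro mult_right_mono) simp_all
    then show "real a / real b * pi \<le> pi" by simp
  qed simp
  have "DL_eigenvalue q r m n = DL_eigenvalue q r m' n'
      \<longleftrightarrow> cos (real m / real n * pi) = cos (real m' / real n' * pi)"
    using assms(1,2) by (simp add: DL_eigenvalue_def)
  also have "\<dots> \<longleftrightarrow> real m / real n * pi = real m' / real n' * pi"
    using cos_inj_pi[OF range[OF assms(3,4)] range[OF assms(5,6)]] by auto
  also have "\<dots> \<longleftrightarrow> real m / real n = real m' / real n'"
    by (simp only: mult_cancel_right pi_neq_zero simp_thms)
  also have "\<dots> \<longleftrightarrow> real m * real n' = real m' * real n" using assms by (simp add: frac_eq_eq)
  also have "\<dots> \<longleftrightarrow> m * n' = m' * n" by (metis of_nat_eq_iff of_nat_mult)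
  finally show ?thesis .
qed

definition mode_eigenvalue :: "nat \<Rightarrow> nat \<Rightarrow> nat \<times> nat \<times> nat \<Rightarrow> real" where
  "mode_eigenvalue q r = (\<lambda>(n, i, m). DL_eigenvalue q r m n)"

text \<open>The modes with the eigenvalue of a reduced fraction \<open>m / n\<close> are those of size \<open>k n\<close> and
  frequency number \<open>k m\<close>.\<close>

lemma sum_weight_eigenvalue:
  assumes q: "q > 0" and r: "r > 0" and mn: "1 \<le> m" "m < n" "coprime m n"
  shows "(\<Sum>j | j \<in> modes (K * n) \<and> mode_eigenvalue q r j = DL_eigenvalue q r m n. weight q r j)
    = (\<Sum>k = 1..K. \<Sum>i = 1..<k * n. weight q r (k * n, i, k * m))"
proof -
  let ?f = "\<lambda>(k, i). (k * n, i, k * m)"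
  let ?S = "SIGMA k:{1..K}. {1..<k * n}"
  have "{j. j \<in> modes (K * n) \<and> mode_eigenvalue q r j = DL_eigenvalue q r m n} = ?f ` ?S"
  proof (intro equalityI subsetI)
    fix j assume "j \<in> {j. j \<in> modes (K * n) \<and> mode_eigenvalue q r j = DL_eigenvalue q r m n}"
    then obtain N i M where j: "j = (N, i, M)" "2 \<le> N" "N \<le> K * n" "1 \<le> i" "i < N" "1 \<le> M" "M < N"
      "DL_eigenvalue q r M N = DL_eigenvalue q r m n"
      by (auto simp: modes_def mode_eigenvalue_def)
    then have eq: "M * n = m * N" using DL_eigenvalue_eq_iff[OF q r j(6,7) mn(1,2)] by simp
    then have "n dvd m * N" by (metis dvd_triv_right)
    then have "n dvd N" using mn(3) by (simp add: coprime_dvd_mult_right_iff coprime_commute)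
    then obtain k where k: "N = k * n" by (auto simp: dvd_def mult.commute)
    then have "M = k * m" using eq mn by simp
    moreover have "k \<in> {1..K}" using k j mn by (cases "k = 0") auto
    ultimately show "j \<in> ?f ` ?S" using j k by (auto intro!: image_eqI[of _ _ "(k, i)"])
  next
    fix j assume "j \<in> ?f ` ?S"
    then obtain p where "p \<in> ?S" "j = ?f p" by blast
    moreover obtain k i where "p = (k, i)" by (cases p)
    ultimately have j: "j = (k * n, i, k * m)" "1 \<le> k" "k \<le> K" "1 \<le> i" "i < k * n" by auto
    have m: "1 \<le> k * m" "k * m < k * n" using j mn by auto
    have "j \<in> modes (K * n)" using j m by (auto simp: modes_def)
    moreover have "mode_eigenvalue q r j = DL_eigenvalue q r m n"
      using DL_eigenvalue_eq_iff[OF q r m mn(1,2)] by (simp add: j mode_eigenvalue_def)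
    ultimately show "j \<in> {j. j \<in> modes (K * n) \<and> mode_eigenvalue q r j = DL_eigenvalue q r m n}"
      by simp
  qed
  moreover have "inj_on ?f ?S" using mn by (auto simp: inj_on_def)
  ultimately have "(\<Sum>j | j \<in> modes (K * n) \<and> mode_eigenvalue q r j = DL_eigenvalue q r m n. weight q r j)
      = (\<Sum>p\<in>?S. weight q r (?f p))"
    by (simp add: sum.reindex)
  also have "\<dots> = (\<Sum>k = 1..K. \<Sum>i = 1..<k * n. weight q r (k * n, i, k * m))"
    by (simp add: sum.Sigma split_def)
  finally show ?thesis .
qed

context forest_product
begin

lemma eigenfun_sqnorm_eq:
  assumes "1 \<le> m" "m < s + t + 2"
  shows "sqnorm V (\<lambda>y. complex_of_real (eigenfun s t m y))
    = (1 - 1 / real q) * (1 - 1 / real r) * real q ^ s * real r ^ t * (real (s + t + 2) / 2)"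
proof -
  let ?\<theta> = "real m / real (s + t + 2) * pi"
  have "(\<Sum>k\<le>s + t. (sin (real m * pi / real (s + t + 2) * real (k + 1)))\<^sup>2)
      = (\<Sum>k\<le>s + t. (sin (?\<theta> * real (Suc k)))\<^sup>2)" by simp
  also have "\<dots> = (\<Sum>k<s + t + 2. (sin (?\<theta> * real k))\<^sup>2)"
    by (simp add: sum.lessThan_Suc_shift lessThan_Suc_atMost[symmetric] del: sum.lessThan_Suc of_nat_Suc)
  also have "\<dots> = real (s + t + 2) / 2"
    using rational_angle(1,2)[OF assms, of 1] rational_angle(3)[OF assms]
    by (intro sum_sin_squares) auto
  finally show ?thesis unfolding eigenfun_sqnorm by simp
qed

lemma eigenfun_weight:
  assumes "1 \<le> m" "m < s + t + 2"
  shows "(cmod (ell2_inner V (\<lambda>y. complex_of_real (eigenfun s t m y)) (delta_fun (o1, o2))))\<^sup>2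
      / sqnorm V (\<lambda>y. complex_of_real (eigenfun s t m y))
    = weight q r (s + t + 2, s + 1, m)"
proof -
  have "ell2_inner V (delta_fun (o1, o2)) (\<lambda>y. complex_of_real (eigenfun s t m y))
      = complex_of_real (eigenfun s t m (o1, o2))"
    using roots_in_V by (subst ell2_inner_finite_support[of "{(o1, o2)}"]) (auto simp: delta_fun_def)
  then have inner: "ell2_inner V (\<lambda>y. complex_of_real (eigenfun s t m y)) (delta_fun (o1, o2))
      = complex_of_real (eigenfun s t m (o1, o2))"
    by (subst ell2_inner_commute) simp
  have q: "real q > 0" "real r > 0" using F1.q_pos F2.q_pos by auto
  have "(a * b * u)\<^sup>2 / (a * b * x * y * (n / 2)) = a * b / (x * y) * (2 / n) * u\<^sup>2"
    for a b u x y n :: real by (simp add: power2_eq_square mult_ac)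
  then have "(eigenfun s t m (o1, o2))\<^sup>2 / sqnorm V (\<lambda>y. complex_of_real (eigenfun s t m y))
    = (1 - 1 / real q) * (1 - 1 / real r) / (real q ^ s * real r ^ t) * (2 / real (s + t + 2))
      * (sin (real m * pi / real (s + t + 2) * real (s + 1)))\<^sup>2"
    unfolding eigenfun_root eigenfun_sqnorm_eq[OF assms] by (simp only:)
  also have "(1 - 1 / real q) * (1 - 1 / real r) / (real q ^ s * real r ^ t)
      = (real q - 1) * (real r - 1) / (real q ^ (s + 1) * real r ^ (s + t + 2 - (s + 1)))"
    using q by (simp add: field_simps)
  finally show ?thesis unfolding inner weight_def by simp
qed

lemma neighbours:
  assumes adj1: "\<And>x y. G1 x y \<longleftrightarrow> y = \<pi>1 x \<or> x = \<pi>1 y"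
    and adj2: "\<And>x y. G2 x y \<longleftrightarrow> y = \<pi>2 x \<or> x = \<pi>2 y"
    and y: "y \<in> V"
  shows "{z. z \<in> V \<and> DL_adj G1 G2 y z}
    = (\<lambda>z. (z, \<pi>2 (snd y))) ` {z. \<pi>1 z = fst y} \<union> (\<lambda>z. (\<pi>1 (fst y), z)) ` {z. \<pi>2 z = snd y}"
    (is "?N = ?A \<union> ?B")
    and "(\<lambda>z. (z, \<pi>2 (snd y))) ` {z. \<pi>1 z = fst y} \<inter> (\<lambda>z. (\<pi>1 (fst y), z)) ` {z. \<pi>2 z = snd y} = {}"
proof -
  obtain y1 y2 where yy: "y = (y1, y2)" by (cases y)
  have h: "h1 y1 + h2 y2 = 0" using y by (simp add: yy V_def)
  show "?N = ?A \<union> ?B"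
  proof (intro equalityI subsetI)
    fix z assume "z \<in> ?N"
    moreover obtain z1 z2 where z: "z = (z1, z2)" by (cases z)
    ultimately have hz: "h1 z1 + h2 z2 = 0"
      and "z1 = \<pi>1 y1 \<or> \<pi>1 z1 = y1" "z2 = \<pi>2 y2 \<or> \<pi>2 z2 = y2"
      by (auto simp: V_def DL_adj_def adj1 adj2 yy)
    moreover have "\<not> (z1 = \<pi>1 y1 \<and> z2 = \<pi>2 y2)"
      using h hz F1.h_parent[of y1] F2.h_parent[of y2] by auto
    moreover have "\<not> (\<pi>1 z1 = y1 \<and> \<pi>2 z2 = y2)"
      using h hz F1.h_parent[of z1] F2.h_parent[of z2] by auto
    ultimately show "z \<in> ?A \<union> ?B" unfolding z yy by auto
  next
    fix z assume "z \<in> ?A \<union> ?B"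
    then consider z1 where "\<pi>1 z1 = y1" "z = (z1, \<pi>2 y2)" | z2 where "\<pi>2 z2 = y2" "z = (\<pi>1 y1, z2)"
      unfolding yy by auto
    then show "z \<in> ?N"
    proof cases
      case 1
      then show ?thesis
        using h F1.h_child[OF 1(1)] F2.h_parent[of y2] by (simp add: V_def DL_adj_def adj1 adj2 yy)
    next
      case 2
      then show ?thesis
        using h F2.h_child[OF 2(1)] F1.h_parent[of y1] by (simp add: V_def DL_adj_def adj1 adj2 yy)
    qed
  qed
  have "\<pi>1 (\<pi>1 y1) \<noteq> y1"
  proof
    assume "\<pi>1 (\<pi>1 y1) = y1"
    from F1.h_child[OF this] show False using F1.h_parent[of y1] by simp
  qed
  then show "?A \<inter> ?B = {}" unfolding yy by auto
qed

lemma walk_eigenfun: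
  assumes adj1: "\<And>x y. G1 x y \<longleftrightarrow> y = \<pi>1 x \<or> x = \<pi>1 y"
    and adj2: "\<And>x y. G2 x y \<longleftrightarrow> y = \<pi>2 x \<or> x = \<pi>2 y"
  shows "DL_walk_op q r V G1 G2 (\<lambda>y. complex_of_real (eigenfun s t m y))
    = (\<lambda>y. complex_of_real (DL_eigenvalue q r m (s + t + 2)) * complex_of_real (eigenfun s t m y))"
proof
  fix y
  show "DL_walk_op q r V G1 G2 (\<lambda>y. complex_of_real (eigenfun s t m y)) y
    = complex_of_real (DL_eigenvalue q r m (s + t + 2)) * complex_of_real (eigenfun s t m y)"
  proof (cases "y \<in> V")
    case False
    then show ?thesis by (simp add: DL_walk_op_def eigenfun_def)
  next
    case True
    note N = neighbours[OF adj1 adj2 True]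
    have "(\<Sum>z | z \<in> V \<and> DL_adj G1 G2 y z. eigenfun s t m z)
        = (\<Sum>z | \<pi>1 z = fst y. eigenfun s t m (z, \<pi>2 (snd y)))
          + (\<Sum>z | \<pi>2 z = snd y. eigenfun s t m (\<pi>1 (fst y), z))"
      unfolding N(1)
      by (subst sum.union_disjoint[OF _ _ N(2)])
         (auto simp: sum.reindex inj_on_def F1.finite_children F2.finite_children)
    also have "\<dots> = 2 * sqrt (real (q * r)) * cos (real m * pi / real (s + t + 2)) * eigenfun s t m y"
      by (rule eigenfun_neighbour_sum[OF True])
    finally have sum: "(\<Sum>z | z \<in> V \<and> DL_adj G1 G2 y z. eigenfun s t m z)
      = 2 * sqrt (real (q * r)) * cos (real m * pi / real (s + t + 2)) * eigenfun s t m y" .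
    have "DL_walk_op q r V G1 G2 (\<lambda>y. complex_of_real (eigenfun s t m y)) y
        = complex_of_real (1 / real (q + r) * (\<Sum>z | z \<in> V \<and> DL_adj G1 G2 y z. eigenfun s t m z))"
      using True by (simp add: DL_walk_op_def)
    also have "\<dots> = complex_of_real (DL_eigenvalue q r m (s + t + 2) * eigenfun s t m y)"
      unfolding sum DL_eigenvalue_def by simp
    finally show ?thesis by simp
  qed
qed

lemma walk_ell2:
  assumes adj1: "\<And>x y. G1 x y \<longleftrightarrow> y = \<pi>1 x \<or> x = \<pi>1 y"
    and adj2: "\<And>x y. G2 x y \<longleftrightarrow> y = \<pi>2 x \<or> x = \<pi>2 y"
    and f: "f \<in> ell2 V"
  shows "DL_walk_op q r V G1 G2 f \<in> ell2 V"
  unfolding DL_walk_op_def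
proof (rule neighbour_sum_ell2[OF f, of _ "q + r"])
  fix y assume y: "y \<in> V"
  let ?A = "(\<lambda>z. (z, \<pi>2 (snd y))) ` {z. \<pi>1 z = fst y}"
  let ?B = "(\<lambda>z. (\<pi>1 (fst y), z)) ` {z. \<pi>2 z = snd y}"
  have "card (?A \<union> ?B) \<le> card ?A + card ?B" by (rule card_Un_le)
  also have "\<dots> \<le> card {z. \<pi>1 z = fst y} + card {z. \<pi>2 z = snd y}"
    by (intro add_mono card_image_le F1.finite_children F2.finite_children)
  finally have "card (?A \<union> ?B) \<le> q + r" by (simp only: F1.card_children F2.card_children)
  moreover have "finite (?A \<union> ?B)" using F1.finite_children F2.finite_children by simp
  ultimately have "finite {z. z \<in> V \<and> DL_adj G1 G2 y z} \<and> card {z. z \<in> V \<and> DL_adj G1 G2 y z} \<le> q + r"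
    unfolding neighbours(1)[OF adj1 adj2 y] by blast
  then show "{z. z \<in> V \<and> DL_adj G1 G2 y z} \<subseteq> V \<and> finite {z. z \<in> V \<and> DL_adj G1 G2 y z} \<and>
      card {z. z \<in> V \<and> DL_adj G1 G2 y z} \<le> q + r" by blast
next
  fix x y assume "x \<in> V" "y \<in> V"
  then show "y \<in> {z. z \<in> V \<and> DL_adj G1 G2 x z} \<longleftrightarrow> x \<in> {z. z \<in> V \<and> DL_adj G1 G2 y z}"
    unfolding DL_adj_def adj1 adj2 by auto
qed

lemma walk_lin:
  "DL_walk_op q r V G1 G2 (\<lambda>x. a * f x + b * g x)
    = (\<lambda>x. a * DL_walk_op q r V G1 G2 f x + b * DL_walk_op q r V G1 G2 g x)"
proof
  fix x
  have "(\<Sum>y\<in>N. a * f y + b * g y) = a * (\<Sum>y\<in>N. f y) + b * (\<Sum>y\<in>N. g y)" for N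
    by (simp only: sum.distrib sum_distrib_left)
  then show "DL_walk_op q r V G1 G2 (\<lambda>x. a * f x + b * g x) x
    = a * DL_walk_op q r V G1 G2 f x + b * DL_walk_op q r V G1 G2 g x"
    unfolding DL_walk_op_def by (simp add: algebra_simps)
qed

lemma atom_lower_bound:
  assumes adj1: "\<And>x y. G1 x y \<longleftrightarrow> y = \<pi>1 x \<or> x = \<pi>1 y"
    and adj2: "\<And>x y. G2 x y \<longleftrightarrow> y = \<pi>2 x \<or> x = \<pi>2 y"
    and q: "q \<ge> 2" and r: "r \<ge> 2"
    and SR: "spectral_resolution V (DL_walk_op q r V G1 G2) E"
  shows "(\<Sum>j | j \<in> modes K \<and> mode_eigenvalue q r j = l. weight q r j)
    \<le> measure (plancherel_measure V E (o1, o2)) {l}"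
proof -
  define f where "f = (\<lambda>(n, i, m). \<lambda>y. complex_of_real (eigenfun (i - 1) (n - i - 1) m y))"
  define J where "J = {j. j \<in> modes K \<and> mode_eigenvalue q r j = l}"
  have J: "\<exists>s t m. j = (s + t + 2, s + 1, m) \<and> 1 \<le> m \<and> m < s + t + 2
      \<and> DL_eigenvalue q r m (s + t + 2) = l
      \<and> f j = (\<lambda>y. complex_of_real (eigenfun s t m y))" if "j \<in> J" for j
  proof -
    obtain n i m where j: "j = (n, i, m)" by (cases j)
    then have *: "1 \<le> i" "i < n" "1 \<le> m" "m < n" "DL_eigenvalue q r m n = l"
      using that by (auto simp: J_def modes_def mode_eigenvalue_def)
    then have n: "(i - 1) + (n - i - 1) + 2 = n" "(i - 1) + 1 = i" by simp_all
    have "j = ((i - 1) + (n - i - 1) + 2, (i - 1) + 1, m) \<and> 1 \<le> m \<and> m < (i - 1) + (n - i - 1) + 2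
      \<and> DL_eigenvalue q r m ((i - 1) + (n - i - 1) + 2) = l
      \<and> f j = (\<lambda>y. complex_of_real (eigenfun (i - 1) (n - i - 1) m y))"
      unfolding n using j * by (simp add: f_def)
    then show ?thesis by blast
  qed
  have pos: "(1 - 1 / real q) * (1 - 1 / real r) * real q ^ s * real r ^ t * (real (s + t + 2) / 2) > 0"
    for s t using q r by simp
  have "(\<Sum>j | j \<in> modes K \<and> mode_eigenvalue q r j = l. weight q r j)
      = (\<Sum>j\<in>J. (cmod (ell2_inner V (f j) (delta_fun (o1, o2))))\<^sup>2 / sqnorm V (f j))"
    unfolding J_def[symmetric]
  proof (rule sum.cong[OF refl])
    fix j assume "j \<in> J"
    then obtain s t m where "j = (s + t + 2, s + 1, m)" "1 \<le> m" "m < s + t + 2"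
      "f j = (\<lambda>y. complex_of_real (eigenfun s t m y))" using J by blast
    then show "weight q r j = (cmod (ell2_inner V (f j) (delta_fun (o1, o2))))\<^sup>2 / sqnorm V (f j)"
      using eigenfun_weight[of m s t] by simp
  qed
  also have "\<dots> \<le> measure (spectral_measure V E (delta_fun (o1, o2))) {l}"
  proof (rule spectral_atom_lower_bound[OF SR walk_lin walk_ell2[OF adj1 adj2]])
    show "finite J" unfolding J_def using finite_modes[of K] by simp
    show "f j \<in> ell2 V" if "j \<in> J" for j using J[OF that] eigenfun_ell2 by auto
    show "sqnorm V (f j) > 0" if "j \<in> J" for j
      using J[OF that] eigenfun_sqnorm_eq pos by (elim exE conjE) (simp only:)
    show "DL_walk_op q r V G1 G2 (f j) = (\<lambda>x. complex_of_real l * f j x)" if "j \<in> J" for j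
      using J[OF that] walk_eigenfun[OF adj1 adj2] by (elim exE conjE) (simp only:)
    show "delta_fun (o1, o2) \<in> ell2 V"
      using roots_in_V by (intro ell2_finite_support[of "{(o1, o2)}"]) (auto simp: delta_fun_def)
    show "ell2_inner V (f j) (f j') = 0" if "j \<in> J" "j' \<in> J" "j \<noteq> j'" for j j'
    proof -
      obtain s t m where j: "j = (s + t + 2, s + 1, m)" "1 \<le> m" "m < s + t + 2"
        "DL_eigenvalue q r m (s + t + 2) = l"
        "f j = (\<lambda>y. complex_of_real (eigenfun s t m y))" using J[OF \<open>j \<in> J\<close>] by blast
      obtain s' t' m' where j': "j' = (s' + t' + 2, s' + 1, m')" "1 \<le> m'" "m' < s' + t' + 2"
        "DL_eigenvalue q r m' (s' + t' + 2) = l"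
        "f j' = (\<lambda>y. complex_of_real (eigenfun s' t' m' y))" using J[OF \<open>j' \<in> J\<close>] by blast
      have "(s, t) \<noteq> (s', t')"
      proof
        \<comment> \<open>For fixed \<open>s\<close> and \<open>t\<close> the eigenvalues are distinct.\<close>
        assume "(s, t) = (s', t')"
        then have "m * (s + t + 2) = m' * (s + t + 2)"
          using DL_eigenvalue_eq_iff[of q r m "s + t + 2" m' "s + t + 2"] j(2-4) j'(2-4) q r by simp
        then have "m = m'" by (simp only: mult_cancel2) simp
        with \<open>(s, t) = (s', t')\<close> j(1) j'(1) \<open>j \<noteq> j'\<close> show False by simp
      qed
      then show ?thesis unfolding j(5) j'(5) by (rule eigenfun_orthogonal)
    qed
  qed
  finally show ?thesis unfolding plancherel_measure_def .
qed

end

theorem corollary4p6: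
  fixes q r :: nat
    and G1 :: "'a \<Rightarrow> 'a \<Rightarrow> bool" and o1 :: 'a and \<omega>1 :: "(nat \<Rightarrow> 'a) set"
    and G2 :: "'b \<Rightarrow> 'b \<Rightarrow> bool" and o2 :: 'b and \<omega>2 :: "(nat \<Rightarrow> 'b) set"
    and V :: "('a \<times> 'b) set"
    and E :: "real set \<Rightarrow> ('a \<times> 'b \<Rightarrow> complex) \<Rightarrow> ('a \<times> 'b \<Rightarrow> complex)"
    and \<mu> :: "real measure"
  assumes "q \<ge> 2" and "r \<ge> 2"
    and "homogeneous_tree q G1" and "\<omega>1 \<in> ends G1"
    and "homogeneous_tree r G2" and "\<omega>2 \<in> ends G2"
    and V_eq: "V = DL_verts G1 o1 \<omega>1 G2 o2 \<omega>2"
    and "spectral_resolution V (DL_walk_op q r V G1 G2) E"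
    and mu_eq: "\<mu> = plancherel_measure V E (o1, o2)"
  shows "(\<forall>m n. 1 \<le> m \<and> m < n \<and> coprime m n \<longrightarrow>
           measure \<mu> {DL_eigenvalue q r m n} =
             (if r \<noteq> q then
                (ln (1 - 1 / real r ^ n) - ln (1 - 1 / real q ^ n)) / (real n * (real r - real q)) *
                (2 * real q * real r * (real q + real r) * (real q - 1) * (real r - 1) *
                   (sin (real m / real n * pi))\<^sup>2 /
                 ((real r - real q)\<^sup>2 + 4 * real q * real r * (sin (real m / real n * pi))\<^sup>2))
              else (real q - 1)\<^sup>2 / (real q ^ n - 1))) \<and>
         emeasure \<mu> (- {DL_eigenvalue q r m n | m n. 1 \<le> m \<and> m < n \<and> coprime m n}) = 0"
proof -
  obtain \<pi>1 where p1: "\<And>x. busemann G1 o1 \<omega>1 (\<pi>1 x) = busemann G1 o1 \<omega>1 x - 1"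
    "\<And>x y. G1 x y \<longleftrightarrow> y = \<pi>1 x \<or> x = \<pi>1 y" "\<And>x. card {y. \<pi>1 y = x} = q"
    "busemann G1 o1 \<omega>1 o1 = 0"
    using homogeneous_tree_parent[OF assms(3,4), of o1] by blast
  obtain \<pi>2 where p2: "\<And>x. busemann G2 o2 \<omega>2 (\<pi>2 x) = busemann G2 o2 \<omega>2 x - 1"
    "\<And>x y. G2 x y \<longleftrightarrow> y = \<pi>2 x \<or> x = \<pi>2 y" "\<And>x. card {y. \<pi>2 y = x} = r"
    "busemann G2 o2 \<omega>2 o2 = 0"
    using homogeneous_tree_parent[OF assms(5,6), of o2] by blast
  interpret D: forest_product \<pi>1 "busemann G1 o1 \<omega>1" q \<pi>2 "busemann G2 o2 \<omega>2" r o1 o2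
    using p1 p2 assms(1,2) by unfold_locales auto
  have V: "V = D.V" unfolding V_eq DL_verts_def D.V_def ..
  have SR: "spectral_resolution D.V (DL_walk_op q r D.V G1 G2) E" using assms(8) unfolding V .
  have E: "resolution_of_identity D.V E" using SR by (simp add: spectral_resolution_def)
  have \<mu>: "\<mu> = spectral_measure D.V E (delta_fun (o1, o2))"
    using mu_eq unfolding V plancherel_measure_def .
  have \<delta>: "delta_fun (o1, o2) \<in> ell2 D.V"
    using D.roots_in_V by (intro ell2_finite_support[of "{(o1, o2)}"]) (auto simp: delta_fun_def)
  note sm = spectral_measure_emeasure[OF E \<delta>, folded \<mu>]
  have "E UNIV (delta_fun (o1, o2)) = delta_fun (o1, o2)"
    using E \<delta> by (simp add: resolution_of_identity_def)
  moreover have "sqnorm D.V (delta_fun (o1, o2)) = 1"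
  proof -
    have "ell2_inner D.V (delta_fun (o1, o2)) (delta_fun (o1, o2)) = 1"
      using D.roots_in_V by (subst ell2_inner_finite_support[of "{(o1, o2)}"]) (auto simp: delta_fun_def)
    then show ?thesis by (simp add: ell2_inner_self)
  qed
  ultimately have one: "measure \<mu> UNIV = 1" by (simp add: sm(6))
  have w: "weight q r j \<ge> 0" for j
    using assms(1,2) unfolding weight_def by (cases j) simp
  note exhausted = exhausted_by_atoms[OF sm(5) sm(2) one finite_modes w
      D.atom_lower_bound[OF p1(2) p2(2) assms(1,2) SR, unfolded plancherel_measure_def, folded \<mu>] sum_weight_tendsto_1[OF assms(1,2)]]
  let ?L = "{DL_eigenvalue q r m n | m n. 1 \<le> m \<and> m < n \<and> coprime m n}"
  have "measure \<mu> {DL_eigenvalue q r m n} = atom_mass q r m n" if mn: "1 \<le> m" "m < n" "coprime m n" for m n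
  proof (rule LIMSEQ_unique)
    have "strict_mono (\<lambda>K. K * n)" using mn by (simp add: strict_mono_def)
    from LIMSEQ_subseq_LIMSEQ[OF exhausted(1) this, of "DL_eigenvalue q r m n"]
    show "(\<lambda>K. \<Sum>k = 1..K. \<Sum>i = 1..<k * n. weight q r (k * n, i, k * m))
        \<longlonglongrightarrow> measure \<mu> {DL_eigenvalue q r m n}"
      using sum_weight_eigenvalue[of q r m n] mn assms(1,2) by (simp add: o_def)
    show "(\<lambda>K. \<Sum>k = 1..K. \<Sum>i = 1..<k * n. weight q r (k * n, i, k * m)) \<longlonglongrightarrow> atom_mass q r m n"
      by (rule sum_weight_tendsto_atom_mass[OF assms(1,2) mn(1,2)])
  qed
  moreover have "emeasure \<mu> (- ?L) = 0"
  proof (rule exhausted(2))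
    have "?L \<subseteq> range (\<lambda>(m, n). DL_eigenvalue q r m n)" by auto
    then have "countable ?L" by (rule countable_subset) simp
    then show "?L \<in> sets borel" by (rule sets.countable[rotated]) simp
    show "mode_eigenvalue q r ` modes K \<subseteq> ?L" for K
    proof
      fix x assume "x \<in> mode_eigenvalue q r ` modes K"
      then obtain N i M where x: "x = DL_eigenvalue q r M N" "1 \<le> M" "M < N"
        by (auto simp: modes_def mode_eigenvalue_def)
      define g where "g = gcd M N"
      have "g > 0" using x by (simp add: g_def)
      obtain m n where mn: "M = m * g" "N = n * g" "coprime m n"
        using gcd_coprime_exists[of M N] x unfolding g_def by auto
      have "1 \<le> m" "m < n" using x mn \<open>g > 0\<close> by auto
      moreover have "DL_eigenvalue q r M N = DL_eigenvalue q r m n"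
        using \<open>g > 0\<close> by (simp add: DL_eigenvalue_def mn)
      ultimately show "x \<in> ?L" using x mn(3) by auto
    qed
  qed
  ultimately show ?thesis unfolding atom_mass_def by blast
qed

end
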